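(* Let $(\Omega,\Sigma,\mu)$ be a non-atomic $\sigma$-finite complete measure space, $\Gamma\subset\Omega$ a measurable set with $\mu(\Gamma)>0$, and let $v,w\in L_0(\Omega)$ be weight functions on $\Gamma$ and $\Omega$, respectively. Let $X=L_{1,v}(\Gamma)+L_{\infty,w}(\Omega)$ be equipped with the norm $\|x\|=\|x\|^{\Sigma}_{w,v}=\inf\{\|y\|_{\infty,w}+\|z\|_{1,v}: x=y+z,\ y\in L_{\infty,w}(\Omega),\ z\in L_{1,v}(\Gamma)\}$. The following conditions are equivalent. (i) $X$ has the Daugavet property. (ii) $X=L_{1,v}$ (that is, $X=L_{1,v}(\Omega)$ as sets with equality of norms). (iii) $\mu(\Omega\setminus\Gamma)=0$ and $\int_\Omega v/w\,d\mu\le1$.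
   Context: All Banach spaces are real. A Banach space $X$ has the Daugavet property if $\|I+T\|=1+\|T\|$ for every rank one bounded linear operator $T:X\to X$. $L_0=L_0(\Omega)$ is the set of ($\mu$-a.e. equivalence classes of) measurable extended-real valued functions on $\Omega$. A function $u\in L_0(\Omega)$ is a weight function on a measurable set $\Gamma\subset\Omega$ if $0<u<\infty$ $\mu$-a.e. on $\Gamma$. $L_{1,u}(\Gamma)=\{x\in L_0: x=0\ \mu\text{-a.e. off }\Gamma,\ \|x\|_{1,u}=\int_\Gamma|xu|\,d\mu<\infty\}$, and $L_{\infty,u}(\Gamma)=\{x\in L_0:x=0\ \mu\text{-a.e. off }\Gamma,\ \|x\|_{\infty,u}=\operatorname{ess\,sup}_{t\in\Gamma}|x(t)u(t)|<\infty\}$; $L_{1,u}=L_{1,u}(\Omega)$. The sum $L_{1,v}(\Gamma)+L_{\infty,w}(\Omega)$ is the set of all $x=y+z$ with $y\in L_{\infty,w}(\Omega)$, $z\in L_{1,v}(\Gamma)$. *)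

theory Defs
  imports "HOL-Probability.Essential_Supremum"
begin

section \<open>Real normed spaces on an explicit carrier\<close>

text \<open>The spaces below depend on the parameters \<open>M\<close>, \<open>\<Gamma>\<close>, \<open>u\<close>, \<open>v\<close>, \<open>w\<close> and so cannot be instances
  of the class \<open>real_normed_vector\<close>; they are given by a carrier set together with operations. The record
  imposes no axioms; the definitions are meant for real Banach spaces, as are the spaces below.\<close>

record 'e nspace =
  carrier :: "'e set"
  vzero :: 'e
  vadd :: "'e \<Rightarrow> 'e \<Rightarrow> 'e"
  vscale :: "real \<Rightarrow> 'e \<Rightarrow> 'e"
  vnorm :: "'e \<Rightarrow> real"

definition bounded_operator :: "'e nspace \<Rightarrow> ('e \<Rightarrow> 'e) \<Rightarrow> bool" where
  "bounded_operator X T \<longleftrightarrow>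
     (\<forall>x\<in>carrier X. T x \<in> carrier X) \<and>
     (\<forall>x\<in>carrier X. \<forall>y\<in>carrier X. T (vadd X x y) = vadd X (T x) (T y)) \<and>
     (\<forall>c. \<forall>x\<in>carrier X. T (vscale X c x) = vscale X c (T x)) \<and>
     (\<exists>K. \<forall>x\<in>carrier X. vnorm X (T x) \<le> K * vnorm X x)"

definition operator_norm :: "'e nspace \<Rightarrow> ('e \<Rightarrow> 'e) \<Rightarrow> real" where
  "operator_norm X T = (SUP x\<in>{x\<in>carrier X. vnorm X x \<le> 1}. vnorm X (T x))"

definition rank_one :: "'e nspace \<Rightarrow> ('e \<Rightarrow> 'e) \<Rightarrow> bool" where
  "rank_one X T \<longleftrightarrow>
     (\<exists>a\<in>carrier X. a \<noteq> vzero X \<and> T ` carrier X = range (\<lambda>c. vscale X c a))"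

definition daugavet_property :: "'e nspace \<Rightarrow> bool" where
  "daugavet_property X \<longleftrightarrow>
     (\<forall>T. bounded_operator X T \<and> rank_one X T \<longrightarrow>
        operator_norm X (\<lambda>x. vadd X x (T x)) = 1 + operator_norm X T)"


section \<open>Measurable functions modulo almost everywhere equality\<close>

definition ae_eq :: "'a measure \<Rightarrow> (('a \<Rightarrow> ereal) \<times> ('a \<Rightarrow> ereal)) set" where
  "ae_eq M = {(f, g). f \<in> borel_measurable M \<and> g \<in> borel_measurable M \<and> (AE t in M. f t = g t)}"

definition L0 :: "'a measure \<Rightarrow> ('a \<Rightarrow> ereal) set set" where
  "L0 M = borel_measurable M // ae_eq M"

lemma equiv_ae_eq: "equiv (borel_measurable M) (ae_eq M)"
  by (rule equivI) (auto simp: ae_eq_def refl_on_def sym_def trans_def elim: eventually_mono eventually_elim2)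

text \<open>The pointwise operations on representatives. On classes of almost everywhere finite functions
  (all members of the spaces that matter here) the sum involves no \<open>\<infinity> - \<infinity>\<close> outside a null set.\<close>

definition L0_zero :: "'a measure \<Rightarrow> ('a \<Rightarrow> ereal) set" where
  "L0_zero M = ae_eq M `` {\<lambda>t. 0}"

definition L0_add :: "'a measure \<Rightarrow> ('a \<Rightarrow> ereal) set \<Rightarrow> ('a \<Rightarrow> ereal) set \<Rightarrow> ('a \<Rightarrow> ereal) set" where
  "L0_add M x y = (\<Union>f\<in>x. \<Union>g\<in>y. ae_eq M `` {\<lambda>t. f t + g t})"

definition L0_scale :: "'a measure \<Rightarrow> real \<Rightarrow> ('a \<Rightarrow> ereal) set \<Rightarrow> ('a \<Rightarrow> ereal) set" where
  "L0_scale M c x = (\<Union>f\<in>x. ae_eq M `` {\<lambda>t. ereal c * f t})"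

lemma L0_add_class:
  assumes "f \<in> borel_measurable M" "g \<in> borel_measurable M"
  shows "L0_add M (ae_eq M `` {f}) (ae_eq M `` {g}) = ae_eq M `` {\<lambda>t. f t + g t}"
proof -
  have "congruent2 (ae_eq M) (ae_eq M) (\<lambda>f g. ae_eq M `` {\<lambda>t. f t + g t})"
    by (rule congruent2I', rule equiv_class_eq[OF equiv_ae_eq]) (auto simp: ae_eq_def elim: eventually_elim2)
  then show ?thesis
    unfolding L0_add_def by (rule UN_equiv_class2[OF equiv_ae_eq equiv_ae_eq _ assms])
qed

lemma L0_scale_class:
  assumes "f \<in> borel_measurable M"
  shows "L0_scale M c (ae_eq M `` {f}) = ae_eq M `` {\<lambda>t. ereal c * f t}"
proof -
  have "congruent (ae_eq M) (\<lambda>f. ae_eq M `` {\<lambda>t. ereal c * f t})"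
    by (rule congruentI, rule equiv_class_eq[OF equiv_ae_eq]) (auto simp: ae_eq_def elim: eventually_mono)
  then show ?thesis
    unfolding L0_scale_def by (rule UN_equiv_class[OF equiv_ae_eq _ assms])
qed

text \<open>The weights are given by representatives \<open>u\<close>, since every notion below depends only on
  the class of \<open>u\<close>. Nothing is required of a weight function on \<open>\<Gamma>\<close> outside \<open>\<Gamma>\<close>.\<close>

definition weight_on :: "'a measure \<Rightarrow> 'a set \<Rightarrow> ('a \<Rightarrow> ereal) \<Rightarrow> bool" where
  "weight_on M \<Gamma> u \<longleftrightarrow> u \<in> borel_measurable M \<and> (AE t in M. t \<in> \<Gamma> \<longrightarrow> 0 < u t \<and> u t < \<infinity>)"

text \<open>The quantities in the next two definitions agree on all representatives of a class in \<open>L0 M\<close>,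
  so \<open>the_elem\<close> picks their common value.\<close>

definition norm_L1 :: "'a measure \<Rightarrow> ('a \<Rightarrow> ereal) \<Rightarrow> 'a set \<Rightarrow> ('a \<Rightarrow> ereal) set \<Rightarrow> ennreal" where
  "norm_L1 M u \<Gamma> x = the_elem ((\<lambda>f. \<integral>\<^sup>+t\<in>\<Gamma>. e2ennreal \<bar>f t * u t\<bar> \<partial>M) ` x)"

definition norm_Linf :: "'a measure \<Rightarrow> ('a \<Rightarrow> ereal) \<Rightarrow> 'a set \<Rightarrow> ('a \<Rightarrow> ereal) set \<Rightarrow> ennreal" where
  "norm_Linf M u \<Gamma> x = the_elem ((\<lambda>f. esssup (restrict_space M \<Gamma>) (\<lambda>t. e2ennreal \<bar>f t * u t\<bar>)) ` x)"

lemma norm_L1_class: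
  assumes "f \<in> borel_measurable M"
  shows "norm_L1 M u \<Gamma> (ae_eq M `` {f}) = (\<integral>\<^sup>+t\<in>\<Gamma>. e2ennreal \<bar>f t * u t\<bar> \<partial>M)"
proof -
  have "(\<integral>\<^sup>+t\<in>\<Gamma>. e2ennreal \<bar>g t * u t\<bar> \<partial>M) = (\<integral>\<^sup>+t\<in>\<Gamma>. e2ennreal \<bar>f t * u t\<bar> \<partial>M)"
    if "g \<in> ae_eq M `` {f}" for g
    using that by (intro nn_integral_cong_AE) (auto simp: ae_eq_def elim: eventually_mono)
  moreover have "f \<in> ae_eq M `` {f}"
    using assms by (simp add: ae_eq_def)
  ultimately have "(\<lambda>f. \<integral>\<^sup>+t\<in>\<Gamma>. e2ennreal \<bar>f t * u t\<bar> \<partial>M) ` (ae_eq M `` {f})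
      = {\<integral>\<^sup>+t\<in>\<Gamma>. e2ennreal \<bar>f t * u t\<bar> \<partial>M}"
    by blast
  then show ?thesis
    by (simp add: norm_L1_def)
qed

lemma norm_Linf_class:
  assumes [measurable]: "f \<in> borel_measurable M" "u \<in> borel_measurable M" and \<Gamma>: "\<Gamma> \<in> sets M"
  shows "norm_Linf M u \<Gamma> (ae_eq M `` {f}) = esssup (restrict_space M \<Gamma>) (\<lambda>t. e2ennreal \<bar>f t * u t\<bar>)"
proof -
  have "esssup (restrict_space M \<Gamma>) (\<lambda>t. e2ennreal \<bar>g t * u t\<bar>)
      = esssup (restrict_space M \<Gamma>) (\<lambda>t. e2ennreal \<bar>f t * u t\<bar>)"
    if "g \<in> ae_eq M `` {f}" for g
  proof (rule esssup_AE_cong)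
    show "AE t in restrict_space M \<Gamma>. e2ennreal \<bar>g t * u t\<bar> = e2ennreal \<bar>f t * u t\<bar>"
      using that \<Gamma> by (auto simp: ae_eq_def AE_restrict_space_iff elim: eventually_mono)
  qed (use that in \<open>auto simp: ae_eq_def intro!: measurable_restrict_space1\<close>)
  moreover have "f \<in> ae_eq M `` {f}"
    by (simp add: ae_eq_def)
  ultimately have "(\<lambda>f. esssup (restrict_space M \<Gamma>) (\<lambda>t. e2ennreal \<bar>f t * u t\<bar>)) ` (ae_eq M `` {f})
      = {esssup (restrict_space M \<Gamma>) (\<lambda>t. e2ennreal \<bar>f t * u t\<bar>)}"
    by blast
  then show ?thesis
    by (simp add: norm_Linf_def)
qed

definition vanishes_off :: "'a measure \<Rightarrow> 'a set \<Rightarrow> ('a \<Rightarrow> ereal) set \<Rightarrow> bool" where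
  "vanishes_off M \<Gamma> x \<longleftrightarrow> (\<forall>f\<in>x. AE t in M. t \<notin> \<Gamma> \<longrightarrow> f t = 0)"

definition L1_space :: "'a measure \<Rightarrow> ('a \<Rightarrow> ereal) \<Rightarrow> 'a set \<Rightarrow> ('a \<Rightarrow> ereal) set nspace" where
  "L1_space M u \<Gamma> =
     \<lparr>carrier = {x \<in> L0 M. vanishes_off M \<Gamma> x \<and> norm_L1 M u \<Gamma> x < \<infinity>},
      vzero = L0_zero M, vadd = L0_add M, vscale = L0_scale M,
      vnorm = (\<lambda>x. enn2real (norm_L1 M u \<Gamma> x))\<rparr>"

definition Linf_space :: "'a measure \<Rightarrow> ('a \<Rightarrow> ereal) \<Rightarrow> 'a set \<Rightarrow> ('a \<Rightarrow> ereal) set nspace" where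
  "Linf_space M u \<Gamma> =
     \<lparr>carrier = {x \<in> L0 M. vanishes_off M \<Gamma> x \<and> norm_Linf M u \<Gamma> x < \<infinity>},
      vzero = L0_zero M, vadd = L0_add M, vscale = L0_scale M,
      vnorm = (\<lambda>x. enn2real (norm_Linf M u \<Gamma> x))\<rparr>"

definition sum_space ::
    "'a measure \<Rightarrow> 'a set \<Rightarrow> ('a \<Rightarrow> ereal) \<Rightarrow> ('a \<Rightarrow> ereal) \<Rightarrow> ('a \<Rightarrow> ereal) set nspace" where
  "sum_space M \<Gamma> v w =
     (let Y = Linf_space M w (space M); Z = L1_space M v \<Gamma> in
     \<lparr>carrier = {L0_add M y z | y z. y \<in> carrier Y \<and> z \<in> carrier Z},
      vzero = L0_zero M, vadd = L0_add M, vscale = L0_scale M,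
      vnorm = (\<lambda>x. Inf {vnorm Y y + vnorm Z z | y z.
                          y \<in> carrier Y \<and> z \<in> carrier Z \<and> x = L0_add M y z})\<rparr>)"


section \<open>Measures\<close>

definition non_atomic :: "'a measure \<Rightarrow> bool" where
  "non_atomic M \<longleftrightarrow>
     (\<forall>A\<in>sets M. 0 < emeasure M A \<longrightarrow>
        (\<exists>B\<in>sets M. B \<subseteq> A \<and> 0 < emeasure M B \<and> 0 < emeasure M (A - B)))"

end

theory Submission
  imports Defs
begin

text \<open>
  Write \<open>V\<close> and \<open>W\<close> for positive real versions of the weights.

  If \<open>\<Gamma>\<close> is conull and \<open>\<integral> V/W \<le> 1\<close>, then \<open>L\<^sub>\<infinity>\<close> embeds contractively into \<open>L\<^sub>1\<close>, so the sum is \<open>L\<^sub>1\<close> with equal norm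
  (\<open>sum_space_eq_L1\<close>). Conversely, if the sum is \<open>L\<^sub>1\<close>, then \<open>1 / W\<close>, of norm at most one, yields \<open>\<integral> V/W \<le> 1\<close>, and the
  complement of \<open>\<Gamma>\<close> must be null because there the norm is a supremum norm, which is not additive on disjoint supports
  (\<open>eq_L1_imp_conull\<close>, \<open>eq_L1_imp_quotient_le\<close>).

  A weighted \<open>L\<^sub>1\<close> over a non-atomic measure has the Daugavet property (\<open>daugavet_of_L1\<close>). For \<open>T = \<phi> \<otimes> a\<close> cut the space into
  finitely many pieces on which \<open>a\<close> has small norm. If \<open>f\<close> nearly norms \<open>\<phi>\<close>, then so does the normalized restriction
  \<open>g\<close> of \<open>f\<close> to a suitable piece, by additivity of the norm. As \<open>g\<close> and \<open>a\<close> are nearly disjoint, \<open>g + \<phi>(g) a\<close> has norm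
  close to \<open>1 + \<bar>\<phi>(g)\<bar> \<parallel>a\<parallel>\<close>.

  If the condition on \<open>\<Gamma>\<close> and the weights fails, there is a density \<open>g \<ge> 0\<close> with \<open>\<integral> g/W = 1\<close> and \<open>g \<le> \<alpha> V\<close> on \<open>\<Gamma>\<close> for some \<open>\<alpha> < 1\<close>,
  comparable to \<open>V\<close> on a set \<open>A \<subseteq> \<Gamma>\<close> of positive measure: if \<open>\<integral> V/W > 1\<close> normalize \<open>V\<close> on a large set, and if the
  complement of \<open>\<Gamma>\<close> is not null put part of the mass there. The functional \<open>\<phi>(f) = \<integral> f g\<close> has norm one on the sum but norm at most
  \<open>\<alpha>\<close> on \<open>L\<^sub>1\<close>. Hence a function in the unit ball at which \<open>\<phi>\<close> is close to one must be close to \<open>1 / W\<close> on \<open>A\<close>, so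
  subtracting \<open>1\<^sub>A / W\<close> nearly erases it there (\<open>slice_estimate\<close>). The rank one operator \<open>T = - \<phi> \<otimes> 1\<^sub>A / W\<close> then satisfies
  \<open>\<parallel>I + T\<parallel> < 1 + \<parallel>T\<parallel>\<close> (\<open>slice_not_daugavet\<close>).
\<close>

section \<open>Classes of real-valued functions\<close>

text \<open>Members of the weighted \<open>L\<^sub>1\<close> and \<open>L\<^sub>\<infinity>\<close> spaces are finite almost everywhere, so each of them is the class
  of a real-valued function. On such representatives the operations of the spaces are the ordinary
  pointwise ones, which avoids extended real arithmetic in everything that follows.\<close>

definition real_class :: "'a measure \<Rightarrow> ('a \<Rightarrow> real) \<Rightarrow> ('a \<Rightarrow> ereal) set" where
  "real_class M f = ae_eq M `` {\<lambda>t. ereal (f t)}"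

lemma real_class_eq_iff:
  assumes [measurable]: "f \<in> borel_measurable M" "g \<in> borel_measurable M"
  shows "real_class M f = real_class M g \<longleftrightarrow> (AE t in M. f t = g t)"
proof -
  have "real_class M f = real_class M g \<longleftrightarrow> ((\<lambda>t. ereal (f t)), (\<lambda>t. ereal (g t))) \<in> ae_eq M"
    unfolding real_class_def by (rule eq_equiv_class_iff[OF equiv_ae_eq]) measurable
  then show ?thesis
    by (simp add: ae_eq_def)
qed

lemma real_class_in_L0: "f \<in> borel_measurable M \<Longrightarrow> real_class M f \<in> L0 M"
  unfolding L0_def real_class_def by (rule quotientI) measurable

lemma L0_zero_eq: "L0_zero M = real_class M (\<lambda>t. 0)"
  by (simp add: L0_zero_def real_class_def zero_ereal_def)

lemma L0_add_real_class:
  assumes [measurable]: "f \<in> borel_measurable M" "g \<in> borel_measurable M"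
  shows "L0_add M (real_class M f) (real_class M g) = real_class M (\<lambda>t. f t + g t)"
  unfolding real_class_def by (subst L0_add_class) auto

lemma L0_scale_real_class:
  assumes [measurable]: "f \<in> borel_measurable M"
  shows "L0_scale M c (real_class M f) = real_class M (\<lambda>t. c * f t)"
  unfolding real_class_def by (subst L0_scale_class) auto

lemma L0_E:
  assumes "x \<in> L0 M"
  obtains f where "f \<in> borel_measurable M" "x = ae_eq M `` {f}"
  using assms unfolding L0_def by (rule quotientE)

lemma ae_class_eq_real_class:
  assumes [measurable]: "f \<in> borel_measurable M" and fin: "AE t in M. \<bar>f t\<bar> \<noteq> \<infinity>"
  shows "ae_eq M `` {f} = real_class M (\<lambda>t. real_of_ereal (f t))"
  unfolding real_class_def
proof (rule equiv_class_eq[OF equiv_ae_eq])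
  show "(f, \<lambda>t. ereal (real_of_ereal (f t))) \<in> ae_eq M"
    using fin by (auto simp: ae_eq_def ereal_real elim: eventually_mono)
qed

lemma vanishes_off_class:
  assumes "f \<in> borel_measurable M"
  shows "vanishes_off M \<Gamma> (ae_eq M `` {f}) \<longleftrightarrow> (AE t in M. t \<notin> \<Gamma> \<longrightarrow> f t = 0)"
proof
  assume "vanishes_off M \<Gamma> (ae_eq M `` {f})"
  moreover have "f \<in> ae_eq M `` {f}"
    using assms by (simp add: ae_eq_def)
  ultimately show "AE t in M. t \<notin> \<Gamma> \<longrightarrow> f t = 0"
    by (simp add: vanishes_off_def)
next
  assume off: "AE t in M. t \<notin> \<Gamma> \<longrightarrow> f t = 0"
  show "vanishes_off M \<Gamma> (ae_eq M `` {f})"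
    unfolding vanishes_off_def
  proof
    fix g assume "g \<in> ae_eq M `` {f}"
    then have "AE t in M. f t = g t"
      by (simp add: ae_eq_def)
    with off show "AE t in M. t \<notin> \<Gamma> \<longrightarrow> g t = 0"
      by eventually_elim simp
  qed
qed

lemma vanishes_off_real_class:
  assumes [measurable]: "f \<in> borel_measurable M"
  shows "vanishes_off M \<Gamma> (real_class M f) \<longleftrightarrow> (AE t in M. t \<notin> \<Gamma> \<longrightarrow> f t = 0)"
  unfolding real_class_def by (subst vanishes_off_class) (simp_all add: zero_ereal_def)

lemma norm_L1_real_class:
  assumes [measurable]: "f \<in> borel_measurable M"
    and vV: "AE t in M. t \<in> \<Gamma> \<longrightarrow> v t = ereal (V t)" and V: "\<And>t. 0 < V t"
    and off: "AE t in M. t \<notin> \<Gamma> \<longrightarrow> f t = 0"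
  shows "norm_L1 M v \<Gamma> (real_class M f) = (\<integral>\<^sup>+t. ennreal (\<bar>f t\<bar> * V t) \<partial>M)"
proof -
  have "norm_L1 M v \<Gamma> (real_class M f) = (\<integral>\<^sup>+t\<in>\<Gamma>. e2ennreal \<bar>ereal (f t) * v t\<bar> \<partial>M)"
    unfolding real_class_def by (rule norm_L1_class) measurable
  also have "\<dots> = (\<integral>\<^sup>+t. ennreal (\<bar>f t\<bar> * V t) \<partial>M)"
    using vV off
  proof (intro nn_integral_cong_AE, eventually_elim)
    case (elim t)
    then show ?case
      using V[of t] by (cases "t \<in> \<Gamma>") (auto simp: abs_mult)
  qed
  finally show ?thesis .
qed

text \<open>A finite integral of \<open>\<bar>f v\<bar>\<close> with \<open>0 < v < \<infinity>\<close> on \<open>\<Gamma>\<close> makes \<open>f\<close> finite almost everywhere on \<open>\<Gamma>\<close>, and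
  off \<open>\<Gamma>\<close> it vanishes; this is where a real representative comes from.\<close>

lemma L1_carrier_iff:
  assumes [measurable]: "\<Gamma> \<in> sets M" "v \<in> borel_measurable M" "V \<in> borel_measurable M"
    and vV: "AE t in M. t \<in> \<Gamma> \<longrightarrow> v t = ereal (V t)" and V: "\<And>t. 0 < V t"
  shows "x \<in> carrier (L1_space M v \<Gamma>) \<longleftrightarrow>
    (\<exists>z\<in>borel_measurable M. x = real_class M z \<and> (AE t in M. t \<notin> \<Gamma> \<longrightarrow> z t = 0)
       \<and> integrable M (\<lambda>t. z t * V t))"
proof
  assume x: "x \<in> carrier (L1_space M v \<Gamma>)"
  then have "x \<in> L0 M"
    by (simp add: L1_space_def)
  then obtain f where [measurable]: "f \<in> borel_measurable M" and xf: "x = ae_eq M `` {f}"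
    by (rule L0_E)
  have off: "AE t in M. t \<notin> \<Gamma> \<longrightarrow> f t = 0"
    using x unfolding xf by (simp add: L1_space_def vanishes_off_class)
  have fin: "(\<integral>\<^sup>+t\<in>\<Gamma>. e2ennreal \<bar>f t * v t\<bar> \<partial>M) < \<infinity>"
    using x unfolding xf by (simp add: L1_space_def norm_L1_class)
  have "AE t in M. e2ennreal \<bar>f t * v t\<bar> * indicator \<Gamma> t \<noteq> \<infinity>"
    using fin by (intro nn_integral_noteq_infinite) auto
  then have "AE t in M. \<bar>f t\<bar> \<noteq> \<infinity>"
    using vV off
  proof eventually_elim
    case (elim t)
    then show ?case
      using V[of t] by (cases "t \<in> \<Gamma>"; cases "f t") auto
  qed
  then have eq: "x = real_class M (\<lambda>t. real_of_ereal (f t))"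
    unfolding xf by (intro ae_class_eq_real_class) auto
  have off': "AE t in M. t \<notin> \<Gamma> \<longrightarrow> real_of_ereal (f t) = 0"
    using off by (auto elim: eventually_mono)
  have "(\<integral>\<^sup>+t. ennreal (\<bar>real_of_ereal (f t)\<bar> * V t) \<partial>M) < \<infinity>"
    using x off' vV V unfolding eq by (simp add: L1_space_def norm_L1_real_class)
  then have "integrable M (\<lambda>t. real_of_ereal (f t) * V t)"
    using less_imp_le[OF V] by (intro integrableI_bounded) (auto simp: abs_mult)
  with eq off' show "\<exists>z\<in>borel_measurable M. x = real_class M z \<and> (AE t in M. t \<notin> \<Gamma> \<longrightarrow> z t = 0)
       \<and> integrable M (\<lambda>t. z t * V t)"
    by (intro bexI[of _ "\<lambda>t. real_of_ereal (f t)"]) auto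
next
  assume "\<exists>z\<in>borel_measurable M. x = real_class M z \<and> (AE t in M. t \<notin> \<Gamma> \<longrightarrow> z t = 0)
       \<and> integrable M (\<lambda>t. z t * V t)"
  then obtain z where [measurable]: "z \<in> borel_measurable M" and x: "x = real_class M z"
    and off: "AE t in M. t \<notin> \<Gamma> \<longrightarrow> z t = 0" and int: "integrable M (\<lambda>t. z t * V t)"
    by blast
  have "(\<integral>\<^sup>+t. ennreal (\<bar>z t\<bar> * V t) \<partial>M) < \<infinity>"
    using int less_imp_le[OF V] unfolding integrable_iff_bounded by (auto simp: abs_mult)
  then show "x \<in> carrier (L1_space M v \<Gamma>)"
    using off vV V unfolding x
    by (simp add: L1_space_def norm_L1_real_class vanishes_off_real_class real_class_in_L0)
qed

lemma L1_norm_real_class: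
  assumes [measurable]: "f \<in> borel_measurable M" "V \<in> borel_measurable M"
    and vV: "AE t in M. t \<in> \<Gamma> \<longrightarrow> v t = ereal (V t)" and V: "\<And>t. 0 < V t"
    and off: "AE t in M. t \<notin> \<Gamma> \<longrightarrow> f t = 0"
  shows "vnorm (L1_space M v \<Gamma>) (real_class M f) = (\<integral>t. \<bar>f t\<bar> * V t \<partial>M)"
proof -
  have "(\<integral>t. \<bar>f t\<bar> * V t \<partial>M) = enn2real (\<integral>\<^sup>+t. ennreal (\<bar>f t\<bar> * V t) \<partial>M)"
    using less_imp_le[OF V] by (intro integral_eq_nn_integral) auto
  then show ?thesis
    using vV V off by (simp add: L1_space_def norm_L1_real_class)
qed

lemma restrict_space_whole: "restrict_space M (space M) = M"
proof (rule measure_eqI)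
  show sets_eq: "sets (restrict_space M (space M)) = sets M"
    unfolding sets_restrict_space by (simp add: sets.Int_space_eq1)
  show "emeasure (restrict_space M (space M)) A = emeasure M A"
    if "A \<in> sets (restrict_space M (space M))" for A
    using that sets_eq sets.sets_into_space[of A M] by (intro emeasure_restrict_space) auto
qed

text \<open>The essential supremum of \<open>\<bar>y W\<bar>\<close> is used only through the almost everywhere bounds that it encodes:
  it is below every nonnegative bound, and it is a bound itself.\<close>

lemma Linf_carrier_iff:
  assumes [measurable]: "w \<in> borel_measurable M" "W \<in> borel_measurable M"
    and wW: "AE t in M. w t = ereal (W t)" and W: "\<And>t. 0 < W t"
  shows "x \<in> carrier (Linf_space M w (space M)) \<longleftrightarrow>
    (\<exists>y\<in>borel_measurable M. x = real_class M y \<and> (\<exists>p. AE t in M. \<bar>y t\<bar> * W t \<le> p))"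
    (is "_ \<longleftrightarrow> ?R")
    and Linf_norm_le: "\<And>y p. \<lbrakk>y \<in> borel_measurable M; 0 \<le> p; AE t in M. \<bar>y t\<bar> * W t \<le> p\<rbrakk>
       \<Longrightarrow> vnorm (Linf_space M w (space M)) (real_class M y) \<le> p"
    and Linf_norm_bound: "\<And>y p. \<lbrakk>y \<in> borel_measurable M; AE t in M. \<bar>y t\<bar> * W t \<le> p\<rbrakk>
       \<Longrightarrow> AE t in M. \<bar>y t\<bar> * W t \<le> vnorm (Linf_space M w (space M)) (real_class M y)"
proof -
  have norm_class: "norm_Linf M w (space M) (ae_eq M `` {f}) = esssup M (\<lambda>t. e2ennreal \<bar>f t * w t\<bar>)"
    if [measurable]: "f \<in> borel_measurable M" for f
    by (subst norm_Linf_class) (simp_all add: restrict_space_whole)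
  have off: "vanishes_off M (space M) (ae_eq M `` {f})" if "f \<in> borel_measurable M" for f
    using that by (simp add: vanishes_off_class)
  have norm_real: "norm_Linf M w (space M) (real_class M y) \<le> ennreal p"
    if [measurable]: "y \<in> borel_measurable M" and p: "AE t in M. \<bar>y t\<bar> * W t \<le> p" for y p
  proof -
    have "AE t in M. e2ennreal \<bar>ereal (y t) * w t\<bar> \<le> ennreal p"
      using p wW
    proof eventually_elim
      case (elim t)
      then show ?case
        using W[of t] by (auto simp: abs_mult intro!: ennreal_leI)
    qed
    then show ?thesis
      unfolding real_class_def by (subst norm_class) (auto intro!: esssup_I)
  qed
  have bound: "AE t in M. \<bar>f t\<bar> \<noteq> \<infinity> \<and> \<bar>real_of_ereal (f t)\<bar> * W t \<le> enn2real (norm_Linf M w (space M) (ae_eq M `` {f}))"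
    if [measurable]: "f \<in> borel_measurable M" and fin: "norm_Linf M w (space M) (ae_eq M `` {f}) < \<infinity>" for f
  proof -
    let ?p = "enn2real (norm_Linf M w (space M) (ae_eq M `` {f}))"
    have "AE t in M. e2ennreal \<bar>f t * w t\<bar> \<le> ennreal ?p"
      using fin by (simp add: norm_class esssup_AE)
    then show ?thesis
      using wW
    proof eventually_elim
      case (elim t)
      then show ?case
        using W[of t] by (cases "f t") (auto simp: abs_mult top_unique)
    qed
  qed
  show "x \<in> carrier (Linf_space M w (space M)) \<longleftrightarrow> ?R"
  proof
    assume x: "x \<in> carrier (Linf_space M w (space M))"
    then have "x \<in> L0 M"
      by (simp add: Linf_space_def)
    then obtain f where f[measurable]: "f \<in> borel_measurable M" and xf: "x = ae_eq M `` {f}"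
      by (rule L0_E)
    have "norm_Linf M w (space M) (ae_eq M `` {f}) < \<infinity>"
      using x by (simp add: Linf_space_def xf)
    from bound[OF f this] have "AE t in M. \<bar>f t\<bar> \<noteq> \<infinity>"
      "AE t in M. \<bar>real_of_ereal (f t)\<bar> * W t \<le> enn2real (norm_Linf M w (space M) x)"
      by (auto simp: xf)
    then show ?R
      by (intro bexI[of _ "\<lambda>t. real_of_ereal (f t)"] conjI exI[of _ "enn2real (norm_Linf M w (space M) x)"])
        (auto simp: xf ae_class_eq_real_class)
  next
    assume ?R
    then obtain y p where [measurable]: "y \<in> borel_measurable M" and x: "x = real_class M y"
      and p: "AE t in M. \<bar>y t\<bar> * W t \<le> p"
      by blast
    have "norm_Linf M w (space M) x \<le> ennreal p"
      unfolding x by (rule norm_real) (use p in auto)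
    then have "norm_Linf M w (space M) x < \<infinity>"
      by (simp add: le_less_trans)
    then show "x \<in> carrier (Linf_space M w (space M))"
      using off[of "\<lambda>t. ereal (y t)"] unfolding x
      by (auto simp: Linf_space_def real_class_in_L0) (simp add: real_class_def)
  qed
  show "vnorm (Linf_space M w (space M)) (real_class M y) \<le> p"
    if "y \<in> borel_measurable M" "0 \<le> p" "AE t in M. \<bar>y t\<bar> * W t \<le> p" for y p
    using norm_real[of y p] that by (simp add: Linf_space_def enn2real_leI)
  show "AE t in M. \<bar>y t\<bar> * W t \<le> vnorm (Linf_space M w (space M)) (real_class M y)"
    if [measurable]: "y \<in> borel_measurable M" and p: "AE t in M. \<bar>y t\<bar> * W t \<le> p" for y p
  proof -
    have "norm_Linf M w (space M) (real_class M y) < \<infinity>"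
      using norm_real[of y p] p by (simp add: le_less_trans)
    then show ?thesis
      using bound[of "\<lambda>t. ereal (y t)"] by (simp add: Linf_space_def real_class_def)
  qed
qed

section \<open>The sum space on the level of real-valued functions\<close>

lemma Inf_eq_Inf_of_cofinal:
  fixes A B :: "real set"
  assumes "A \<subseteq> B" and cofinal: "\<And>r. r \<in> B \<Longrightarrow> \<exists>s\<in>A. s \<le> r" and ne: "B \<noteq> {}" and bdd: "bdd_below B"
  shows "Inf A = Inf B"
proof (rule antisym)
  have "A \<noteq> {}"
    using ne cofinal by blast
  then show "Inf B \<le> Inf A"
    using bdd \<open>A \<subseteq> B\<close> by (intro cInf_superset_mono)
  have "bdd_below A"
    using bdd \<open>A \<subseteq> B\<close> by (rule bdd_below_mono)
  then show "Inf A \<le> Inf B"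
    using ne cofinal by (intro cInf_mono) auto
qed

text \<open>The real functions \<open>V\<close> and \<open>W\<close> are versions of the weights that are positive everywhere. They agree
  with \<open>v\<close> almost everywhere on \<open>\<Gamma>\<close> and with \<open>w\<close> almost everywhere; off \<open>\<Gamma>\<close> the values of \<open>V\<close> are arbitrary, as are those of \<open>v\<close>.\<close>

locale weighted_sum =
  fixes M :: "'a measure" and \<Gamma> :: "'a set" and v w :: "'a \<Rightarrow> ereal" and V W :: "'a \<Rightarrow> real"
  assumes \<Gamma>[measurable]: "\<Gamma> \<in> sets M"
    and v[measurable]: "v \<in> borel_measurable M" and w[measurable]: "w \<in> borel_measurable M"
    and V[measurable]: "V \<in> borel_measurable M" and W[measurable]: "W \<in> borel_measurable M"
    and V_pos: "0 < V t" and W_pos: "0 < W t"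
    and v_eq: "AE t in M. t \<in> \<Gamma> \<longrightarrow> v t = ereal (V t)"
    and w_eq: "AE t in M. w t = ereal (W t)"
begin

lemma abs_V[simp]: "\<bar>V t\<bar> = V t" and abs_W[simp]: "\<bar>W t\<bar> = W t"
  using V_pos[of t] W_pos[of t] by simp_all

abbreviation X :: "('a \<Rightarrow> ereal) set nspace" where
  "X \<equiv> sum_space M \<Gamma> v w"

text \<open>The class of \<open>f\<close> is the sum of \<open>f - z\<close> in \<open>L\<^sub>\<infinity>\<close>, with norm at most \<open>p\<close>, and of \<open>z\<close> in \<open>L\<^sub>1\<close>, and the two norms add
  up to at most \<open>r\<close>. Admitting every larger \<open>r\<close> makes the predicate monotone in \<open>r\<close> and leaves the infimum
  unchanged.\<close>

definition split_le :: "('a \<Rightarrow> real) \<Rightarrow> real \<Rightarrow> bool" where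
  "split_le f r \<longleftrightarrow> (\<exists>z p. z \<in> borel_measurable M \<and> 0 \<le> p \<and> (AE t in M. \<bar>f t - z t\<bar> * W t \<le> p)
     \<and> (AE t in M. t \<notin> \<Gamma> \<longrightarrow> z t = 0) \<and> integrable M (\<lambda>t. z t * V t)
     \<and> p + (\<integral>t. \<bar>z t\<bar> * V t \<partial>M) \<le> r)"

lemma split_leI:
  assumes "z \<in> borel_measurable M" "0 \<le> p" "AE t in M. \<bar>f t - z t\<bar> * W t \<le> p"
    "AE t in M. t \<notin> \<Gamma> \<longrightarrow> z t = 0" "integrable M (\<lambda>t. z t * V t)"
    "p + (\<integral>t. \<bar>z t\<bar> * V t \<partial>M) \<le> r"
  shows "split_le f r"
  using assms unfolding split_le_def by blast

lemma split_leE: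
  assumes "split_le f r"
  obtains z p where "z \<in> borel_measurable M" "0 \<le> p" "AE t in M. \<bar>f t - z t\<bar> * W t \<le> p"
    "AE t in M. t \<notin> \<Gamma> \<longrightarrow> z t = 0" "integrable M (\<lambda>t. z t * V t)"
    "p + (\<integral>t. \<bar>z t\<bar> * V t \<partial>M) \<le> r"
  using assms unfolding split_le_def by blast

lemma integral_V_nonneg: "0 \<le> (\<integral>t. \<bar>f t\<bar> * V t \<partial>M)"
  using less_imp_le[OF V_pos] by (intro integral_nonneg_AE) auto

lemma split_le_nonneg: "split_le f r \<Longrightarrow> 0 \<le> r"
  by (elim split_leE) (smt (verit) integral_V_nonneg)

definition sum_fun :: "('a \<Rightarrow> real) \<Rightarrow> bool" where
  "sum_fun f \<longleftrightarrow> f \<in> borel_measurable M \<and> (\<exists>r. split_le f r)"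

text \<open>The seminorm on functions that induces the norm of the sum space, see \<open>X_norm\<close> below.\<close>

definition N :: "('a \<Rightarrow> real) \<Rightarrow> real" where
  "N f = Inf {r. split_le f r}"

lemma sum_fun_measurable: "sum_fun f \<Longrightarrow> f \<in> borel_measurable M"
  by (simp add: sum_fun_def)

lemma N_le: "split_le f r \<Longrightarrow> N f \<le> r"
  unfolding N_def by (rule cInf_lower) (auto intro: bdd_belowI[of _ 0] split_le_nonneg)

lemma N_nonneg: "sum_fun f \<Longrightarrow> 0 \<le> N f"
  unfolding N_def sum_fun_def by (rule cInf_greatest) (auto intro: split_le_nonneg)

lemma split_le_mono: "split_le f r \<Longrightarrow> r \<le> s \<Longrightarrow> split_le f s"
  unfolding split_le_def by (meson order_trans)

lemma split_le_gt_N: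
  assumes "sum_fun f" "N f < r"
  shows "split_le f r"
proof -
  have "\<exists>s\<in>{r. split_le f r}. s < r"
    using assms unfolding N_def sum_fun_def by (intro cInf_lessD) auto
  then show ?thesis
    using split_le_mono by auto
qed

lemma split_le_add:
  assumes "split_le f r" "split_le g s"
  shows "split_le (\<lambda>t. f t + g t) (r + s)"
proof -
  from assms(1) obtain z p where z[measurable]: "z \<in> borel_measurable M" and p: "0 \<le> p"
    "AE t in M. \<bar>f t - z t\<bar> * W t \<le> p" and z0: "AE t in M. t \<notin> \<Gamma> \<longrightarrow> z t = 0"
    and zi: "integrable M (\<lambda>t. z t * V t)" and r: "p + (\<integral>t. \<bar>z t\<bar> * V t \<partial>M) \<le> r"
    by (rule split_leE)
  from assms(2) obtain z' p' where z'[measurable]: "z' \<in> borel_measurable M" and p': "0 \<le> p'"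
    "AE t in M. \<bar>g t - z' t\<bar> * W t \<le> p'" and z0': "AE t in M. t \<notin> \<Gamma> \<longrightarrow> z' t = 0"
    and zi': "integrable M (\<lambda>t. z' t * V t)" and s: "p' + (\<integral>t. \<bar>z' t\<bar> * V t \<partial>M) \<le> s"
    by (rule split_leE)
  have abs_int: "integrable M (\<lambda>t. \<bar>z t\<bar> * V t)" "integrable M (\<lambda>t. \<bar>z' t\<bar> * V t)"
    using integrable_abs[OF zi] integrable_abs[OF zi'] by (simp_all add: abs_mult)
  have int: "integrable M (\<lambda>t. (z t + z' t) * V t)"
    using zi zi' by (simp add: distrib_right)
  show ?thesis
  proof (rule split_leI[where z = "\<lambda>t. z t + z' t" and p = "p + p'"])
    show "AE t in M. \<bar>f t + g t - (z t + z' t)\<bar> * W t \<le> p + p'"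
      using p(2) p'(2)
    proof eventually_elim
      case (elim t)
      have "\<bar>f t + g t - (z t + z' t)\<bar> * W t \<le> (\<bar>f t - z t\<bar> + \<bar>g t - z' t\<bar>) * W t"
        using W_pos[of t] by (intro mult_right_mono) auto
      with elim show ?case
        by (simp add: distrib_right)
    qed
    have "(\<integral>t. \<bar>z t + z' t\<bar> * V t \<partial>M) \<le> (\<integral>t. \<bar>z t\<bar> * V t + \<bar>z' t\<bar> * V t \<partial>M)"
    proof (rule integral_mono)
      show "integrable M (\<lambda>t. \<bar>z t + z' t\<bar> * V t)"
        using integrable_abs[OF int] by (simp add: abs_mult)
      show "\<bar>z t + z' t\<bar> * V t \<le> \<bar>z t\<bar> * V t + \<bar>z' t\<bar> * V t" for t
        using V_pos[of t] by (simp flip: distrib_right) 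
    qed (use abs_int in auto)
    also have "\<dots> = (\<integral>t. \<bar>z t\<bar> * V t \<partial>M) + (\<integral>t. \<bar>z' t\<bar> * V t \<partial>M)"
      using abs_int by simp
    finally show "p + p' + (\<integral>t. \<bar>z t + z' t\<bar> * V t \<partial>M) \<le> r + s"
      using r s by simp
    show "AE t in M. t \<notin> \<Gamma> \<longrightarrow> z t + z' t = 0"
      using z0 z0' by eventually_elim simp
  qed (use p(1) p'(1) int in auto)
qed

lemma split_le_scale:
  assumes "split_le f r"
  shows "split_le (\<lambda>t. c * f t) (\<bar>c\<bar> * r)"
proof -
  from assms obtain z p where z[measurable]: "z \<in> borel_measurable M" and p: "0 \<le> p"
    "AE t in M. \<bar>f t - z t\<bar> * W t \<le> p" and z0: "AE t in M. t \<notin> \<Gamma> \<longrightarrow> z t = 0"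
    and zi: "integrable M (\<lambda>t. z t * V t)" and r: "p + (\<integral>t. \<bar>z t\<bar> * V t \<partial>M) \<le> r"
    by (rule split_leE)
  show ?thesis
  proof (rule split_leI[where z = "\<lambda>t. c * z t" and p = "\<bar>c\<bar> * p"])
    show "AE t in M. \<bar>c * f t - c * z t\<bar> * W t \<le> \<bar>c\<bar> * p"
      using p(2)
    proof eventually_elim
      case (elim t)
      have eq: "\<bar>c * f t - c * z t\<bar> * W t = \<bar>c\<bar> * (\<bar>f t - z t\<bar> * W t)"
        by (simp only: abs_mult mult.assoc flip: right_diff_distrib)
      show ?case
        unfolding eq by (rule mult_left_mono[OF elim]) simp
    qed
    have "(\<integral>t. \<bar>c * z t\<bar> * V t \<partial>M) = \<bar>c\<bar> * (\<integral>t. \<bar>z t\<bar> * V t \<partial>M)"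
      by (simp add: abs_mult mult.assoc)
    then show "\<bar>c\<bar> * p + (\<integral>t. \<bar>c * z t\<bar> * V t \<partial>M) \<le> \<bar>c\<bar> * r"
      using r by (simp add: mult_left_mono flip: distrib_left)
    show "AE t in M. t \<notin> \<Gamma> \<longrightarrow> c * z t = 0"
      using z0 by eventually_elim simp
    show "integrable M (\<lambda>t. c * z t * V t)"
      using zi by (simp add: mult.assoc)
  qed (use p(1) in auto)
qed

lemma sum_fun_add: "sum_fun f \<Longrightarrow> sum_fun g \<Longrightarrow> sum_fun (\<lambda>t. f t + g t)"
  by (auto simp: sum_fun_def intro: split_le_add)

lemma sum_fun_scale: "sum_fun f \<Longrightarrow> sum_fun (\<lambda>t. c * f t)"
  by (auto simp: sum_fun_def intro: split_le_scale)

lemma N_triangle: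
  assumes "sum_fun f" "sum_fun g"
  shows "N (\<lambda>t. f t + g t) \<le> N f + N g"
proof (rule field_le_epsilon)
  fix e :: real assume "0 < e"
  then have "split_le f (N f + e / 2)" "split_le g (N g + e / 2)"
    using assms by (auto intro: split_le_gt_N)
  from N_le[OF split_le_add[OF this]] show "N (\<lambda>t. f t + g t) \<le> N f + N g + e"
    by simp
qed

lemma N_scale_le:
  assumes "sum_fun f"
  shows "N (\<lambda>t. c * f t) \<le> \<bar>c\<bar> * N f"
proof (rule field_le_epsilon)
  fix e :: real assume e: "0 < e"
  define d where "d = e / (\<bar>c\<bar> + 1)"
  have d: "0 < d" "\<bar>c\<bar> * d \<le> e"
    using e unfolding d_def by (auto simp: field_simps)
  have "split_le f (N f + d)"
    using assms d by (auto intro: split_le_gt_N)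
  from N_le[OF split_le_scale[OF this]] show "N (\<lambda>t. c * f t) \<le> \<bar>c\<bar> * N f + e"
    using d by (simp add: distrib_left) (meson add_left_mono order_trans)
qed

lemma N_scale:
  assumes "sum_fun f"
  shows "N (\<lambda>t. c * f t) = \<bar>c\<bar> * N f"
proof (cases "c = 0")
  case True
  then show ?thesis
    using N_scale_le[OF assms, of 0] N_nonneg[OF sum_fun_scale[OF assms, of 0]] by simp
next
  case False
  have "N f \<le> \<bar>inverse c\<bar> * N (\<lambda>t. c * f t)"
    using N_scale_le[OF sum_fun_scale[OF assms, of c], of "inverse c"] False
    by (simp flip: mult.assoc)
  then have "\<bar>c\<bar> * N f \<le> N (\<lambda>t. c * f t)"
    using False by (simp add: field_simps abs_inverse)
  with N_scale_le[OF assms, of c] show ?thesis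
    by simp
qed

lemma split_le_cong:
  assumes eq: "AE t in M. f t = g t" and "split_le f r"
  shows "split_le g r"
proof -
  from assms(2) obtain z p where z: "z \<in> borel_measurable M" "0 \<le> p"
    and p: "AE t in M. \<bar>f t - z t\<bar> * W t \<le> p" and z': "AE t in M. t \<notin> \<Gamma> \<longrightarrow> z t = 0"
    "integrable M (\<lambda>t. z t * V t)" "p + (\<integral>t. \<bar>z t\<bar> * V t \<partial>M) \<le> r"
    by (rule split_leE)
  have "AE t in M. \<bar>g t - z t\<bar> * W t \<le> p"
    using eq p by eventually_elim simp
  then show ?thesis
    by (intro split_leI[OF z _ z'])
qed

lemma Y_carrier_iff:
  "x \<in> carrier (Linf_space M w (space M)) \<longleftrightarrow>
    (\<exists>y\<in>borel_measurable M. x = real_class M y \<and> (\<exists>p. AE t in M. \<bar>y t\<bar> * W t \<le> p))"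
  by (rule Linf_carrier_iff[OF w W w_eq W_pos])

lemma Z_carrier_iff:
  "x \<in> carrier (L1_space M v \<Gamma>) \<longleftrightarrow>
    (\<exists>z\<in>borel_measurable M. x = real_class M z \<and> (AE t in M. t \<notin> \<Gamma> \<longrightarrow> z t = 0)
       \<and> integrable M (\<lambda>t. z t * V t))"
  by (rule L1_carrier_iff[OF \<Gamma> v V v_eq V_pos])

text \<open>The defining set of sums of norms has the same infimum as the set of the admissible \<open>r\<close>.\<close>

lemma split_le_imp_decomposition:
  assumes f[measurable]: "f \<in> borel_measurable M" and "split_le f r"
  obtains y z where "y \<in> carrier (Linf_space M w (space M))" "z \<in> carrier (L1_space M v \<Gamma>)"
    "real_class M f = L0_add M y z"
    "vnorm (Linf_space M w (space M)) y + vnorm (L1_space M v \<Gamma>) z \<le> r"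
proof -
  from assms(2) obtain z p where z[measurable]: "z \<in> borel_measurable M" and p: "0 \<le> p"
    "AE t in M. \<bar>f t - z t\<bar> * W t \<le> p" and z0: "AE t in M. t \<notin> \<Gamma> \<longrightarrow> z t = 0"
    and zi: "integrable M (\<lambda>t. z t * V t)" and r: "p + (\<integral>t. \<bar>z t\<bar> * V t \<partial>M) \<le> r"
    by (rule split_leE)
  show thesis
  proof (rule that)
    show "real_class M (\<lambda>t. f t - z t) \<in> carrier (Linf_space M w (space M))"
      unfolding Y_carrier_iff using p(2) by (intro bexI[of _ "\<lambda>t. f t - z t"]) auto
    show "real_class M z \<in> carrier (L1_space M v \<Gamma>)"
      unfolding Z_carrier_iff using z0 zi by auto
    show "real_class M f = L0_add M (real_class M (\<lambda>t. f t - z t)) (real_class M z)"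
      by (subst L0_add_real_class) auto
    have "vnorm (Linf_space M w (space M)) (real_class M (\<lambda>t. f t - z t)) \<le> p"
      by (rule Linf_norm_le[OF w W w_eq W_pos]) (use p in auto)
    moreover have "vnorm (L1_space M v \<Gamma>) (real_class M z) = (\<integral>t. \<bar>z t\<bar> * V t \<partial>M)"
      by (rule L1_norm_real_class[OF z V v_eq V_pos z0])
    ultimately show "vnorm (Linf_space M w (space M)) (real_class M (\<lambda>t. f t - z t))
        + vnorm (L1_space M v \<Gamma>) (real_class M z) \<le> r"
      using r by simp
  qed
qed

lemma decomposition_imp_split_le:
  assumes y: "y \<in> carrier (Linf_space M w (space M))" and z: "z \<in> carrier (L1_space M v \<Gamma>)"
  obtains f where "f \<in> borel_measurable M" "L0_add M y z = real_class M f"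
    "split_le f (vnorm (Linf_space M w (space M)) y + vnorm (L1_space M v \<Gamma>) z)"
proof -
  from y obtain y' p where y'[measurable]: "y' \<in> borel_measurable M" and yeq: "y = real_class M y'"
    and p: "AE t in M. \<bar>y' t\<bar> * W t \<le> p"
    unfolding Y_carrier_iff by blast
  from z obtain z' where z'[measurable]: "z' \<in> borel_measurable M" and zeq: "z = real_class M z'"
    and z0: "AE t in M. t \<notin> \<Gamma> \<longrightarrow> z' t = 0" and zi: "integrable M (\<lambda>t. z' t * V t)"
    unfolding Z_carrier_iff by blast
  show thesis
  proof (rule that)
    show "L0_add M y z = real_class M (\<lambda>t. y' t + z' t)"
      unfolding yeq zeq by (rule L0_add_real_class[OF y' z'])
    show "split_le (\<lambda>t. y' t + z' t) (vnorm (Linf_space M w (space M)) y + vnorm (L1_space M v \<Gamma>) z)"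
    proof (rule split_leI[OF z' _ _ z0 zi])
      show "0 \<le> vnorm (Linf_space M w (space M)) y"
        by (simp add: Linf_space_def)
      show "AE t in M. \<bar>y' t + z' t - z' t\<bar> * W t \<le> vnorm (Linf_space M w (space M)) y"
        using Linf_norm_bound[OF w W w_eq W_pos y' p] by (simp add: yeq)
      show "vnorm (Linf_space M w (space M)) y + (\<integral>t. \<bar>z' t\<bar> * V t \<partial>M)
          \<le> vnorm (Linf_space M w (space M)) y + vnorm (L1_space M v \<Gamma>) z"
        by (simp add: zeq L1_norm_real_class[OF z' V v_eq V_pos z0])
    qed
  qed measurable
qed

lemma X_carrier_iff: "x \<in> carrier X \<longleftrightarrow> (\<exists>f. sum_fun f \<and> x = real_class M f)"
proof
  assume "x \<in> carrier X"
  then obtain y z where "y \<in> carrier (Linf_space M w (space M))" "z \<in> carrier (L1_space M v \<Gamma>)"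
    and x: "x = L0_add M y z"
    by (auto simp: sum_space_def Let_def)
  then show "\<exists>f. sum_fun f \<and> x = real_class M f"
    by (metis decomposition_imp_split_le sum_fun_def)
next
  assume "\<exists>f. sum_fun f \<and> x = real_class M f"
  then obtain f r where f: "f \<in> borel_measurable M" "split_le f r" and x: "x = real_class M f"
    by (auto simp: sum_fun_def)
  from f obtain y z where "y \<in> carrier (Linf_space M w (space M))" "z \<in> carrier (L1_space M v \<Gamma>)"
    "real_class M f = L0_add M y z"
    by (rule split_le_imp_decomposition)
  then show "x \<in> carrier X"
    unfolding x by (auto simp: sum_space_def Let_def)
qed

lemma X_norm:
  assumes "sum_fun f"
  shows "vnorm X (real_class M f) = N f"
proof -
  let ?Y = "Linf_space M w (space M)" and ?Z = "L1_space M v \<Gamma>"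
  let ?S = "{vnorm ?Y y + vnorm ?Z z | y z. y \<in> carrier ?Y \<and> z \<in> carrier ?Z \<and> real_class M f = L0_add M y z}"
  have f[measurable]: "f \<in> borel_measurable M" and ne: "{r. split_le f r} \<noteq> {}"
    using assms by (auto simp: sum_fun_def)
  have S: "\<exists>s\<in>?S. s \<le> r" if "split_le f r" for r
  proof -
    from f that obtain y z where "y \<in> carrier ?Y" "z \<in> carrier ?Z"
      "real_class M f = L0_add M y z" "vnorm ?Y y + vnorm ?Z z \<le> r"
      by (rule split_le_imp_decomposition)
    then show ?thesis
      by auto
  qed
  have S_sub: "?S \<subseteq> {r. split_le f r}"
  proof clarify
    fix y z assume yz: "y \<in> carrier ?Y" "z \<in> carrier ?Z" "real_class M f = L0_add M y z"
    from yz(1,2) obtain g where g: "g \<in> borel_measurable M"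
      "L0_add M y z = real_class M g" "split_le g (vnorm ?Y y + vnorm ?Z z)"
      by (rule decomposition_imp_split_le)
    then have "AE t in M. g t = f t"
      using yz(3) real_class_eq_iff[OF g(1) f] by simp
    then show "split_le f (vnorm ?Y y + vnorm ?Z z)"
      using g(3) by (rule split_le_cong)
  qed
  have "Inf ?S = N f"
    unfolding N_def
    by (rule Inf_eq_Inf_of_cofinal[OF S_sub _ ne]) (use S in \<open>auto intro: bdd_belowI[of _ 0] split_le_nonneg\<close>)
  then show ?thesis
    by (simp add: sum_space_def Let_def)
qed

lemma X_zero: "vzero X = real_class M (\<lambda>t. 0)"
  by (simp add: sum_space_def Let_def L0_zero_eq)

lemma X_add:
  "f \<in> borel_measurable M \<Longrightarrow> g \<in> borel_measurable M \<Longrightarrow>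
    vadd X (real_class M f) (real_class M g) = real_class M (\<lambda>t. f t + g t)"
  by (simp add: sum_space_def Let_def L0_add_real_class)

lemma X_scale:
  "f \<in> borel_measurable M \<Longrightarrow> vscale X c (real_class M f) = real_class M (\<lambda>t. c * f t)"
  by (simp add: sum_space_def Let_def L0_scale_real_class)

end

section \<open>When the sum space is a weighted \<open>L\<^sub>1\<close>\<close>

context weighted_sum
begin

lemma split_le_of_bounded:
  assumes "0 \<le> p" "AE t in M. \<bar>f t\<bar> * W t \<le> p"
  shows "split_le f p"
  by (rule split_leI[where z = "\<lambda>t. 0" and p = p]) (use assms in auto)

lemma split_le_of_integrable:
  assumes "f \<in> borel_measurable M" "AE t in M. t \<notin> \<Gamma> \<longrightarrow> f t = 0" "integrable M (\<lambda>t. f t * V t)"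
  shows "split_le f (\<integral>t. \<bar>f t\<bar> * V t \<partial>M)"
  by (rule split_leI[where z = f and p = 0]) (use assms in auto)

lemma integrable_abs_V: "integrable M (\<lambda>t. f t * V t) \<Longrightarrow> integrable M (\<lambda>t. \<bar>f t\<bar> * V t)"
  using integrable_abs[of M "\<lambda>t. f t * V t"] by (simp add: abs_mult)

text \<open>If \<open>\<integral> V/W \<le> 1\<close>, then \<open>\<bar>y\<bar> W \<le> p\<close> gives \<open>\<integral> \<bar>y\<bar> V \<le> p \<integral> V/W \<le> p\<close>: moving the bounded summand into
  \<open>L\<^sub>1\<close> does not increase its norm, so no splitting beats the trivial one.\<close>

lemma split_le_imp_L1:
  assumes int: "integrable M (\<lambda>t. V t / W t)" and le: "(\<integral>t. V t / W t \<partial>M) \<le> 1"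
    and f[measurable]: "f \<in> borel_measurable M" and "split_le f r"
  shows "integrable M (\<lambda>t. f t * V t)" "(\<integral>t. \<bar>f t\<bar> * V t \<partial>M) \<le> r"
proof -
  from assms(4) obtain z p where z[measurable]: "z \<in> borel_measurable M" and p0: "0 \<le> p"
    and p: "AE t in M. \<bar>f t - z t\<bar> * W t \<le> p" and z0: "AE t in M. t \<notin> \<Gamma> \<longrightarrow> z t = 0"
    and zi: "integrable M (\<lambda>t. z t * V t)" and r: "p + (\<integral>t. \<bar>z t\<bar> * V t \<partial>M) \<le> r"
    by (rule split_leE)
  have dom: "AE t in M. \<bar>f t\<bar> * V t \<le> p * (V t / W t) + \<bar>z t\<bar> * V t"
    using p
  proof eventually_elim
    case (elim t)
    have "\<bar>f t - z t\<bar> \<le> p / W t"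
      using elim W_pos[of t] by (simp add: field_simps)
    then have "\<bar>f t\<bar> \<le> p / W t + \<bar>z t\<bar>"
      by linarith
    then have "\<bar>f t\<bar> * V t \<le> (p / W t + \<bar>z t\<bar>) * V t"
      using V_pos[of t] by (intro mult_right_mono) auto
    then show ?case
      by (simp add: distrib_right)
  qed
  have dom_int: "integrable M (\<lambda>t. p * (V t / W t) + \<bar>z t\<bar> * V t)"
    by (intro Bochner_Integration.integrable_add integrable_mult_right int integrable_abs_V zi)
  show fi: "integrable M (\<lambda>t. f t * V t)"
    by (rule Bochner_Integration.integrable_bound[OF dom_int])
      (use dom in \<open>auto simp: abs_mult elim!: eventually_mono\<close>)
  have "(\<integral>t. \<bar>f t\<bar> * V t \<partial>M) \<le> (\<integral>t. p * (V t / W t) + \<bar>z t\<bar> * V t \<partial>M)"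
    by (rule integral_mono_AE[OF integrable_abs_V[OF fi] dom_int dom])
  also have "\<dots> = p * (\<integral>t. V t / W t \<partial>M) + (\<integral>t. \<bar>z t\<bar> * V t \<partial>M)"
    using int integrable_abs_V[OF zi] by (simp del: times_divide_eq_right)
  also have "\<dots> \<le> r"
    using r mult_left_mono[OF le p0] by simp
  finally show "(\<integral>t. \<bar>f t\<bar> * V t \<partial>M) \<le> r" .
qed

lemma sum_fun_iff_L1:
  assumes conull: "AE t in M. t \<in> \<Gamma>"
    and int: "integrable M (\<lambda>t. V t / W t)" and le: "(\<integral>t. V t / W t \<partial>M) \<le> 1"
  shows "sum_fun f \<longleftrightarrow> f \<in> borel_measurable M \<and> integrable M (\<lambda>t. f t * V t)"
proof
  assume f: "f \<in> borel_measurable M \<and> integrable M (\<lambda>t. f t * V t)"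
  have "AE t in M. t \<notin> \<Gamma> \<longrightarrow> f t = 0"
    using conull by eventually_elim simp
  with f show "sum_fun f"
    using split_le_of_integrable[of f] by (auto simp: sum_fun_def)
qed (auto simp: sum_fun_def intro: split_le_imp_L1[OF int le])

lemma N_eq_L1:
  assumes conull: "AE t in M. t \<in> \<Gamma>"
    and int: "integrable M (\<lambda>t. V t / W t)" and le: "(\<integral>t. V t / W t \<partial>M) \<le> 1"
    and f: "f \<in> borel_measurable M" "integrable M (\<lambda>t. f t * V t)"
  shows "N f = (\<integral>t. \<bar>f t\<bar> * V t \<partial>M)"
proof (rule antisym)
  have s: "split_le f (\<integral>t. \<bar>f t\<bar> * V t \<partial>M)"
    using conull f by (intro split_le_of_integrable) auto
  then show "N f \<le> (\<integral>t. \<bar>f t\<bar> * V t \<partial>M)"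
    by (rule N_le)
  show "(\<integral>t. \<bar>f t\<bar> * V t \<partial>M) \<le> N f"
    unfolding N_def using s split_le_imp_L1(2)[OF int le f(1)] by (intro cInf_greatest) auto
qed

lemma conull_iff: "emeasure M (space M - \<Gamma>) = 0 \<longleftrightarrow> (AE t in M. t \<in> \<Gamma>)"
  by (subst AE_iff_measurable[of "space M - \<Gamma>"]) auto

lemma nn_integral_quotient_le_iff:
  assumes conull: "AE t in M. t \<in> \<Gamma>"
  shows "(\<integral>\<^sup>+t. e2ennreal (v t / w t) \<partial>M) = (\<integral>\<^sup>+t. ennreal (V t / W t) \<partial>M)"
    and "(\<integral>\<^sup>+t. e2ennreal (v t / w t) \<partial>M) \<le> 1 \<longleftrightarrow>
      integrable M (\<lambda>t. V t / W t) \<and> (\<integral>t. V t / W t \<partial>M) \<le> 1"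
proof -
  have nonneg: "0 \<le> V t / W t" for t
    using V_pos[of t] W_pos[of t] by simp
  show eq: "(\<integral>\<^sup>+t. e2ennreal (v t / w t) \<partial>M) = (\<integral>\<^sup>+t. ennreal (V t / W t) \<partial>M)"
    using conull v_eq w_eq
  proof (intro nn_integral_cong_AE, eventually_elim)
    case (elim t)
    then show ?case
      using W_pos[of t] by simp
  qed
  show "(\<integral>\<^sup>+t. e2ennreal (v t / w t) \<partial>M) \<le> 1 \<longleftrightarrow>
      integrable M (\<lambda>t. V t / W t) \<and> (\<integral>t. V t / W t \<partial>M) \<le> 1"
    unfolding eq
  proof safe
    assume le: "(\<integral>\<^sup>+t. ennreal (V t / W t) \<partial>M) \<le> 1"
    then show int: "integrable M (\<lambda>t. V t / W t)"
      using nonneg by (intro integrableI_bounded) (auto simp: le_less_trans)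
    show "(\<integral>t. V t / W t \<partial>M) \<le> 1"
      using le nonneg int by (simp add: nn_integral_eq_integral)
  next
    assume "integrable M (\<lambda>t. V t / W t)" "(\<integral>t. V t / W t \<partial>M) \<le> 1"
    then show "(\<integral>\<^sup>+t. ennreal (V t / W t) \<partial>M) \<le> 1"
      using nonneg by (simp add: nn_integral_eq_integral)
  qed
qed

lemma sum_space_eq_L1:
  assumes conull: "AE t in M. t \<in> \<Gamma>"
    and int: "integrable M (\<lambda>t. V t / W t)" and le: "(\<integral>t. V t / W t \<partial>M) \<le> 1"
  shows "carrier X = carrier (L1_space M v (space M))"
    and "x \<in> carrier X \<Longrightarrow> vnorm X x = vnorm (L1_space M v (space M)) x"
proof -
  have v_eq': "AE t in M. t \<in> space M \<longrightarrow> v t = ereal (V t)"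
    using v_eq conull by eventually_elim simp
  have iff: "x \<in> carrier (L1_space M v (space M)) \<longleftrightarrow>
      (\<exists>z\<in>borel_measurable M. x = real_class M z \<and> integrable M (\<lambda>t. z t * V t))" for x
    by (subst L1_carrier_iff[OF _ v V v_eq' V_pos]) auto
  show "carrier X = carrier (L1_space M v (space M))"
    by (auto simp: X_carrier_iff iff sum_fun_iff_L1[OF assms])
  show "vnorm X x = vnorm (L1_space M v (space M)) x" if "x \<in> carrier X"
  proof -
    from that obtain f where f: "sum_fun f" "x = real_class M f"
      by (auto simp: X_carrier_iff)
    then have fi: "f \<in> borel_measurable M" "integrable M (\<lambda>t. f t * V t)"
      by (auto simp: sum_fun_iff_L1[OF assms])
    then have "vnorm (L1_space M v (space M)) x = (\<integral>t. \<bar>f t\<bar> * V t \<partial>M)"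
      unfolding f(2) by (intro L1_norm_real_class[OF _ V v_eq' V_pos]) auto
    with f(1) fi show ?thesis
      by (simp add: f(2) X_norm N_eq_L1[OF assms])
  qed
qed

text \<open>Off \<open>\<Gamma>\<close> the integrable summand vanishes, so there the norm is a supremum norm and \<open>1\<^sub>C / W\<close> has norm one
  however large the set \<open>C\<close> is.\<close>

lemma N_indicator_off:
  assumes C[measurable]: "C \<in> sets M" and off: "C \<inter> \<Gamma> = {}" and pos: "0 < emeasure M C"
  shows "sum_fun (\<lambda>t. indicator C t / W t)" "N (\<lambda>t. indicator C t / W t) = 1"
proof -
  let ?f = "\<lambda>t. indicator C t / W t :: real"
  have s: "split_le ?f 1"
    using W_pos by (intro split_le_of_bounded) (auto simp: abs_mult split: split_indicator)
  then show "sum_fun ?f"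
    by (auto simp: sum_fun_def)
  show "N ?f = 1"
  proof (rule antisym)
    show "N ?f \<le> 1"
      using s by (rule N_le)
    show "1 \<le> N ?f"
      unfolding N_def
    proof (rule cInf_greatest)
      fix r assume "r \<in> {r. split_le ?f r}"
      then obtain z p where p: "AE t in M. \<bar>?f t - z t\<bar> * W t \<le> p"
        and z0: "AE t in M. t \<notin> \<Gamma> \<longrightarrow> z t = 0" and r: "p + (\<integral>t. \<bar>z t\<bar> * V t \<partial>M) \<le> r"
        by (auto elim: split_leE)
      have "AE t in M. t \<in> C \<longrightarrow> 1 \<le> p"
        using p z0
      proof eventually_elim
        case (elim t)
        then show ?case
          using off W_pos[of t] by (auto simp: abs_mult)
      qed
      then have "1 \<le> p"
        using pos AE_iff_measurable[OF C, of "\<lambda>t. t \<notin> C"] sets.sets_into_space[OF C]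
        by (cases "1 \<le> p") (auto simp: Int_absorb1 Collect_conj_eq)
      then show "1 \<le> r"
        using r integral_V_nonneg[of z] by simp
    qed (use s in auto)
  qed
qed

text \<open>An \<open>L\<^sub>1\<close> norm is additive on disjoint supports. Splitting the complement of \<open>\<Gamma>\<close> into two sets of positive
  measure would therefore give \<open>1 = 1 + 1\<close>.\<close>

lemma eq_L1_imp_conull:
  assumes na: "non_atomic M"
    and carrier: "carrier X = carrier (L1_space M v (space M))"
    and norm: "\<forall>x\<in>carrier X. vnorm X x = vnorm (L1_space M v (space M)) x"
  shows "AE t in M. t \<in> \<Gamma>"
proof (rule ccontr)
  let ?D = "space M - \<Gamma>"
  assume "\<not> (AE t in M. t \<in> \<Gamma>)"
  then have "0 < emeasure M ?D"
    by (simp flip: conull_iff add: zero_less_iff_neq_zero)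
  then obtain B where B[measurable]: "B \<in> sets M" and BD: "B \<subseteq> ?D"
    and pos: "0 < emeasure M B" "0 < emeasure M (?D - B)"
    using na[unfolded non_atomic_def, rule_format, of ?D] by auto
  define h where "h t = e2ennreal \<bar>ereal (1 / W t) * v t\<bar>" for t
  have [measurable]: "h \<in> borel_measurable M"
    unfolding h_def by measurable
  have fin: "(\<integral>\<^sup>+t. h t * indicator C t \<partial>M) < \<infinity>" and one: "enn2real (\<integral>\<^sup>+t. h t * indicator C t \<partial>M) = 1"
    if C[measurable]: "C \<in> sets M" and "C \<inter> \<Gamma> = {}" "0 < emeasure M C" for C
  proof -
    let ?x = "real_class M (\<lambda>t. indicator C t / W t)"
    have "norm_L1 M v (space M) ?x = (\<integral>\<^sup>+t\<in>space M. e2ennreal \<bar>ereal (indicator C t / W t) * v t\<bar> \<partial>M)"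
      unfolding real_class_def by (rule norm_L1_class) measurable
    also have "\<dots> = (\<integral>\<^sup>+t. h t * indicator C t \<partial>M)"
      by (intro nn_integral_cong) (auto simp: h_def zero_ereal_def[symmetric] e2ennreal_neg split: split_indicator)
    finally have eq: "norm_L1 M v (space M) ?x = (\<integral>\<^sup>+t. h t * indicator C t \<partial>M)" .
    have "?x \<in> carrier X"
      using N_indicator_off(1)[OF that] by (auto simp: X_carrier_iff)
    moreover from this have "norm_L1 M v (space M) ?x < \<infinity>"
      unfolding carrier by (simp add: L1_space_def)
    moreover have "vnorm X ?x = 1"
      using N_indicator_off[OF that] by (simp add: X_norm)
    ultimately show "(\<integral>\<^sup>+t. h t * indicator C t \<partial>M) < \<infinity>"
        "enn2real (\<integral>\<^sup>+t. h t * indicator C t \<partial>M) = 1"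
      using norm by (auto simp: eq[symmetric] L1_space_def)
  qed
  have "(\<integral>\<^sup>+t. h t * indicator ?D t \<partial>M) =
      (\<integral>\<^sup>+t. h t * indicator B t + h t * indicator (?D - B) t \<partial>M)"
    using BD by (intro nn_integral_cong) (auto split: split_indicator)
  also have "\<dots> = (\<integral>\<^sup>+t. h t * indicator B t \<partial>M) + (\<integral>\<^sup>+t. h t * indicator (?D - B) t \<partial>M)"
    by (rule nn_integral_add) auto
  finally have "enn2real (\<integral>\<^sup>+t. h t * indicator ?D t \<partial>M) =
      enn2real (\<integral>\<^sup>+t. h t * indicator B t \<partial>M) + enn2real (\<integral>\<^sup>+t. h t * indicator (?D - B) t \<partial>M)"
    using fin[OF B] fin[of "?D - B"] BD pos by (subst enn2real_plus[symmetric]) auto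
  moreover have "B \<inter> \<Gamma> = {}" "?D \<inter> \<Gamma> = {}" "(?D - B) \<inter> \<Gamma> = {}"
    using BD by auto
  ultimately show False
    using one[OF B] one[of ?D] one[of "?D - B"] pos \<open>0 < emeasure M ?D\<close> by auto
qed

text \<open>The function \<open>1 / W\<close> has norm at most one in the sum, and its \<open>L\<^sub>1\<close> norm is \<open>\<integral> V/W\<close>.\<close>

lemma eq_L1_imp_quotient_le:
  assumes conull: "AE t in M. t \<in> \<Gamma>"
    and carrier: "carrier X = carrier (L1_space M v (space M))"
    and norm: "\<forall>x\<in>carrier X. vnorm X x = vnorm (L1_space M v (space M)) x"
  shows "(\<integral>\<^sup>+t. e2ennreal (v t / w t) \<partial>M) \<le> 1"
proof -
  let ?x = "real_class M (\<lambda>t. 1 / W t)"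
  have s: "split_le (\<lambda>t. 1 / W t) 1"
    using W_pos by (intro split_le_of_bounded) auto
  then have f: "sum_fun (\<lambda>t. 1 / W t)"
    by (auto simp: sum_fun_def)
  then have x: "?x \<in> carrier X"
    by (auto simp: X_carrier_iff)
  have v_eq': "AE t in M. t \<in> space M \<longrightarrow> v t = ereal (V t)"
    using v_eq conull by eventually_elim simp
  have "norm_L1 M v (space M) ?x = (\<integral>\<^sup>+t. ennreal (\<bar>1 / W t\<bar> * V t) \<partial>M)"
    by (rule norm_L1_real_class[OF _ v_eq' V_pos]) auto
  then have eq: "norm_L1 M v (space M) ?x = (\<integral>\<^sup>+t. e2ennreal (v t / w t) \<partial>M)"
    by (simp add: nn_integral_quotient_le_iff(1)[OF conull])
  have "norm_L1 M v (space M) ?x < \<infinity>"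
    using x unfolding carrier by (simp add: L1_space_def)
  moreover have "enn2real (norm_L1 M v (space M) ?x) \<le> 1"
    using x norm N_le[OF s] X_norm[OF f] by (simp add: L1_space_def)
  ultimately show ?thesis
    unfolding eq by (metis ennreal_enn2real ennreal_le_1 infinity_ennreal_def)
qed

end

section \<open>A functional that destroys the Daugavet property\<close>

context weighted_sum
begin

text \<open>Integration against \<open>g\<close> has norm \<open>\<integral> g/W = 1\<close> on \<open>L\<^sub>\<infinity>\<close> but norm at most \<open>\<alpha>\<close> on \<open>L\<^sub>1\<close>. With \<open>\<alpha> \<le> 1\<close> it has norm at most one
  on the sum; with \<open>\<alpha> < 1\<close> its thin slices consist of functions that are nearly bounded by \<open>1 / W\<close>.\<close>

lemma functional_bound:
  assumes g[measurable]: "g \<in> borel_measurable M" and g0: "\<And>t. 0 \<le> g t"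
    and gi: "integrable M (\<lambda>t. g t / W t)" and g1: "(\<integral>t. g t / W t \<partial>M) = 1"
    and gV: "AE t in M. t \<in> \<Gamma> \<longrightarrow> g t \<le> \<alpha> * V t" and \<alpha>: "0 \<le> \<alpha>"
  shows functional_bound_Linf: "\<And>y p. \<lbrakk>y \<in> borel_measurable M; AE t in M. \<bar>y t\<bar> * W t \<le> p\<rbrakk> \<Longrightarrow>
        integrable M (\<lambda>t. y t * g t) \<and> \<bar>\<integral>t. y t * g t \<partial>M\<bar> \<le> p"
    and functional_bound_L1: "\<And>z. \<lbrakk>z \<in> borel_measurable M; AE t in M. t \<notin> \<Gamma> \<longrightarrow> z t = 0;
          integrable M (\<lambda>t. z t * V t)\<rbrakk> \<Longrightarrow>
        integrable M (\<lambda>t. z t * g t) \<and> \<bar>\<integral>t. z t * g t \<partial>M\<bar> \<le> \<alpha> * (\<integral>t. \<bar>z t\<bar> * V t \<partial>M)"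
    and functional_bound_N: "\<And>f. \<alpha> \<le> 1 \<Longrightarrow> sum_fun f \<Longrightarrow>
        integrable M (\<lambda>t. f t * g t) \<and> \<bar>\<integral>t. f t * g t \<partial>M\<bar> \<le> N f"
proof -
  have dominated: "integrable M (\<lambda>t. f t * g t) \<and> \<bar>\<integral>t. f t * g t \<partial>M\<bar> \<le> (\<integral>t. h t \<partial>M)"
    if [measurable]: "f \<in> borel_measurable M" and h: "integrable M h"
      and le: "AE t in M. \<bar>f t\<bar> * g t \<le> h t" for f h
  proof -
    have abs_le: "AE t in M. norm (f t * g t) \<le> h t"
      using le g0 by (simp add: abs_mult)
    moreover have "AE t in M. norm (f t * g t) \<le> norm (h t)"
      using abs_le by eventually_elim auto
    ultimately have i: "integrable M (\<lambda>t. f t * g t)"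
      by (intro Bochner_Integration.integrable_bound[OF h]) auto
    have "\<bar>\<integral>t. f t * g t \<partial>M\<bar> \<le> (\<integral>t. \<bar>f t * g t\<bar> \<partial>M)"
      by (rule integral_abs_bound)
    also have "\<dots> \<le> (\<integral>t. h t \<partial>M)"
      using abs_le by (intro integral_mono_AE integrable_abs i h) simp
    finally show ?thesis
      using i by simp
  qed
  show Y: "integrable M (\<lambda>t. y t * g t) \<and> \<bar>\<integral>t. y t * g t \<partial>M\<bar> \<le> p"
    if [measurable]: "y \<in> borel_measurable M" and p: "AE t in M. \<bar>y t\<bar> * W t \<le> p" for y p
  proof -
    have "AE t in M. \<bar>y t\<bar> * g t \<le> p * (g t / W t)"
      using p
    proof eventually_elim
      case (elim t)
      have "\<bar>y t\<bar> * g t = \<bar>y t\<bar> * W t * (g t / W t)"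
        using W_pos[of t] by simp
      also have "\<dots> \<le> p * (g t / W t)"
        using elim W_pos[of t] g0[of t] by (intro mult_right_mono) auto
      finally show ?case .
    qed
    from dominated[OF _ _ this] show ?thesis
      using gi g1 by (simp del: times_divide_eq_right)
  qed
  show Z: "integrable M (\<lambda>t. z t * g t) \<and> \<bar>\<integral>t. z t * g t \<partial>M\<bar> \<le> \<alpha> * (\<integral>t. \<bar>z t\<bar> * V t \<partial>M)"
    if [measurable]: "z \<in> borel_measurable M" and z0: "AE t in M. t \<notin> \<Gamma> \<longrightarrow> z t = 0"
      and zi: "integrable M (\<lambda>t. z t * V t)" for z
  proof -
    have "AE t in M. \<bar>z t\<bar> * g t \<le> \<alpha> * (\<bar>z t\<bar> * V t)"
      using z0 gV
    proof eventually_elim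
      case (elim t)
      then show ?case
        using mult_left_mono[of "g t" "\<alpha> * V t" "\<bar>z t\<bar>"] by (cases "t \<in> \<Gamma>") (auto simp: ac_simps)
    qed
    from dominated[OF _ _ this] show ?thesis
      using integrable_abs_V[OF zi] by simp
  qed
  show "integrable M (\<lambda>t. f t * g t) \<and> \<bar>\<integral>t. f t * g t \<partial>M\<bar> \<le> N f"
    if \<alpha>1: "\<alpha> \<le> 1" and f: "sum_fun f" for f
  proof -
    have [measurable]: "f \<in> borel_measurable M"
      using f by (rule sum_fun_measurable)
    have step: "integrable M (\<lambda>t. f t * g t) \<and> \<bar>\<integral>t. f t * g t \<partial>M\<bar> \<le> r" if "split_le f r" for r
    proof -
      from that obtain z p where z[measurable]: "z \<in> borel_measurable M"
        and p: "AE t in M. \<bar>f t - z t\<bar> * W t \<le> p" and z0: "AE t in M. t \<notin> \<Gamma> \<longrightarrow> z t = 0"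
        and zi: "integrable M (\<lambda>t. z t * V t)" and r: "p + (\<integral>t. \<bar>z t\<bar> * V t \<partial>M) \<le> r"
        by (rule split_leE)
      have y: "integrable M (\<lambda>t. (f t - z t) * g t)" "\<bar>\<integral>t. (f t - z t) * g t \<partial>M\<bar> \<le> p"
        using Y[OF _ p] by auto
      have z': "integrable M (\<lambda>t. z t * g t)" "\<bar>\<integral>t. z t * g t \<partial>M\<bar> \<le> \<alpha> * (\<integral>t. \<bar>z t\<bar> * V t \<partial>M)"
        using Z[OF z z0 zi] by auto
      have split: "(\<lambda>t. f t * g t) = (\<lambda>t. (f t - z t) * g t + z t * g t)"
        by (simp add: algebra_simps)
      have "\<alpha> * (\<integral>t. \<bar>z t\<bar> * V t \<partial>M) \<le> 1 * (\<integral>t. \<bar>z t\<bar> * V t \<partial>M)"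
        by (rule mult_right_mono[OF \<alpha>1 integral_V_nonneg])
      then show ?thesis
        unfolding split using y z' r by simp
    qed
    obtain r0 where "split_le f r0"
      using f by (auto simp: sum_fun_def)
    then show ?thesis
      unfolding N_def using step by (auto intro!: cInf_greatest)
  qed
qed

text \<open>A function \<open>f\<close> in a thin slice of the unit ball splits as \<open>y + z\<close> with \<open>z\<close> small in \<open>L\<^sub>1\<close>, because putting mass
  into \<open>z\<close> is penalized by the factor \<open>\<alpha> < 1\<close>. Then \<open>y \<le> p / W\<close> with \<open>p\<close> close to one, while the integral of \<open>y\<close> against
  \<open>g\<close> is also close to one; so \<open>y\<close> is close to \<open>1 / W\<close> in the \<open>L\<^sub>1\<close> norm with weight \<open>g\<close>, hence on \<open>A\<close>, where \<open>g \<ge> c V\<close>,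
  in the norm of the sum. Subtracting \<open>\<phi>(f) 1\<^sub>A / W\<close> therefore nearly cancels \<open>y\<close> on \<open>A\<close> and leaves a function whose norm is
  not much above one.\<close>

lemma slice_estimate:
  assumes g[measurable]: "g \<in> borel_measurable M" and g0: "\<And>t. 0 \<le> g t"
    and gi: "integrable M (\<lambda>t. g t / W t)" and g1: "(\<integral>t. g t / W t \<partial>M) = 1"
    and gV: "AE t in M. t \<in> \<Gamma> \<longrightarrow> g t \<le> \<alpha> * V t" and \<alpha>: "0 \<le> \<alpha>" "\<alpha> < 1"
    and A[measurable]: "A \<in> sets M" and A\<Gamma>: "A \<subseteq> \<Gamma>"
    and c: "0 < c" and cA: "\<And>t. t \<in> A \<Longrightarrow> c * V t \<le> g t"
    and f[measurable]: "f \<in> borel_measurable M" and fr: "split_le f (1 + \<eta>)" and \<eta>: "0 < \<eta>"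
    and slice: "1 - \<eta> \<le> (\<integral>t. f t * g t \<partial>M)"
  shows "N (\<lambda>t. f t - (\<integral>t. f t * g t \<partial>M) * (indicator A t / W t)) \<le> 1 + (1 + (4 + 4 / (1 - \<alpha>)) / c) * \<eta>"
proof -
  define \<theta> where "\<theta> = (\<integral>t. f t * g t \<partial>M)"
  from fr obtain z p where z[measurable]: "z \<in> borel_measurable M" and p0: "0 \<le> p"
    and p: "AE t in M. \<bar>f t - z t\<bar> * W t \<le> p" and z0: "AE t in M. t \<notin> \<Gamma> \<longrightarrow> z t = 0"
    and zi: "integrable M (\<lambda>t. z t * V t)" and r: "p + (\<integral>t. \<bar>z t\<bar> * V t \<partial>M) \<le> 1 + \<eta>"
    by (rule split_leE)
  define q where "q = (\<integral>t. \<bar>z t\<bar> * V t \<partial>M)"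
  define y where "y t = f t - z t" for t
  have [measurable]: "y \<in> borel_measurable M"
    unfolding y_def by measurable
  have q0: "0 \<le> q"
    unfolding q_def by (rule integral_V_nonneg)
  have py: "AE t in M. \<bar>y t\<bar> * W t \<le> p"
    using p by (simp add: y_def)
  have yi: "integrable M (\<lambda>t. y t * g t)"
    using functional_bound_Linf[OF g g0 gi g1 gV \<alpha>(1) _ py] by auto
  have ybound: "\<bar>\<integral>t. y t * g t \<partial>M\<bar> \<le> p"
    using functional_bound_Linf[OF g g0 gi g1 gV \<alpha>(1) _ py] by auto
  have zgi: "integrable M (\<lambda>t. z t * g t)" and zbound: "\<bar>\<integral>t. z t * g t \<partial>M\<bar> \<le> \<alpha> * q"
    using functional_bound_L1[OF g g0 gi g1 gV \<alpha>(1) z z0 zi] by (auto simp: q_def)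
  have \<theta>_split: "\<theta> = (\<integral>t. y t * g t \<partial>M) + (\<integral>t. z t * g t \<partial>M)"
  proof -
    have "(\<lambda>t. f t * g t) = (\<lambda>t. y t * g t + z t * g t)"
      by (simp add: y_def algebra_simps)
    then show ?thesis
      unfolding \<theta>_def using yi zgi by simp
  qed
  have \<alpha>q: "\<alpha> * q \<le> q"
    using mult_right_mono[of \<alpha> 1 q] \<alpha> q0 by simp
  have "(1 - \<alpha>) * q \<le> 2 * \<eta>"
    using slice r ybound zbound \<theta>_split unfolding \<theta>_def[symmetric] q_def[symmetric]
    by (simp add: algebra_simps)
  then have q_le: "q \<le> 2 * \<eta> / (1 - \<alpha>)"
    using \<alpha> by (simp add: field_simps)
  have y_low: "p - (\<integral>t. y t * g t \<partial>M) \<le> 2 * \<eta> + q"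
    using slice r zbound \<theta>_split \<alpha>q q0 unfolding \<theta>_def[symmetric] q_def[symmetric] by linarith
  have p\<theta>: "\<bar>p - \<theta>\<bar> \<le> 2 * \<eta> + q"
    using slice r zbound ybound \<theta>_split \<alpha>q q0 \<eta> unfolding \<theta>_def[symmetric] q_def[symmetric] by linarith
  \<comment> \<open>What remains of \<open>y\<close> on \<open>A\<close> after the subtraction; it joins the \<open>L\<^sub>1\<close> summand.\<close>
  define u where "u t = (y t - \<theta> / W t) * indicator A t" for t
  have [measurable]: "u \<in> borel_measurable M"
    unfolding u_def by measurable
  \<comment> \<open>\<open>h\<close> dominates \<open>\<bar>y - \<theta> / W\<bar> g\<close>, since \<open>p / W - y \<ge> 0\<close>, and its integral can be computed.\<close>
  define h where "h t = (p * (g t / W t) - y t * g t) + \<bar>p - \<theta>\<bar> * (g t / W t)" for t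
  have hi: "integrable M h"
    unfolding h_def by (intro Bochner_Integration.integrable_add Bochner_Integration.integrable_diff integrable_mult_right gi yi)
  have h_int: "(\<integral>t. h t \<partial>M) = p - (\<integral>t. y t * g t \<partial>M) + \<bar>p - \<theta>\<bar>"
    unfolding h_def using gi yi g1 by (simp del: times_divide_eq_right)
  have u_le: "AE t in M. \<bar>u t\<bar> * V t \<le> h t / c"
    using py
  proof eventually_elim
    case (elim t)
    have y_le: "\<bar>y t\<bar> \<le> p / W t"
      using elim W_pos[of t] by (simp add: field_simps)
    have "\<bar>y t - \<theta> / W t\<bar> \<le> (p / W t - y t) + \<bar>p / W t - \<theta> / W t\<bar>"
      using y_le by linarith
    also have "\<bar>p / W t - \<theta> / W t\<bar> = \<bar>p - \<theta>\<bar> / W t"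
      by (simp flip: diff_divide_distrib)
    finally have "\<bar>y t - \<theta> / W t\<bar> * g t \<le> ((p / W t - y t) + \<bar>p - \<theta>\<bar> / W t) * g t"
      using g0[of t] by (rule mult_right_mono)
    also have "\<dots> = h t"
      by (simp add: h_def algebra_simps)
    finally have le: "\<bar>y t - \<theta> / W t\<bar> * g t \<le> h t" .
    have h0: "0 \<le> h t"
      using le g0[of t] by (smt (verit) mult_nonneg_nonneg)
    show ?case
    proof (cases "t \<in> A")
      case True
      have "\<bar>u t\<bar> * V t * c \<le> \<bar>y t - \<theta> / W t\<bar> * g t"
        using mult_left_mono[OF cA[OF True], of "\<bar>y t - \<theta> / W t\<bar>"] True
        by (simp add: u_def ac_simps)
      with le c show ?thesis
        by (simp add: pos_le_divide_eq)
    next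
      case False
      then show ?thesis
        using h0 c by (simp add: u_def)
    qed
  qed
  have ui: "integrable M (\<lambda>t. u t * V t)"
  proof (rule Bochner_Integration.integrable_bound[OF integrable_divide[OF hi, of c]])
    show "AE t in M. norm (u t * V t) \<le> norm (h t / c)"
      using u_le
    proof eventually_elim
      case (elim t)
      then show ?case
        using abs_ge_self[of "h t / c"] unfolding real_norm_def by (simp add: abs_mult del: abs_divide)
    qed
  qed measurable
  have "(\<integral>t. \<bar>u t\<bar> * V t \<partial>M) \<le> (\<integral>t. h t / c \<partial>M)"
    by (rule integral_mono_AE[OF integrable_abs_V[OF ui] integrable_divide[OF hi] u_le])
  also have "\<dots> = (\<integral>t. h t \<partial>M) / c"
    by simp
  also have "\<dots> \<le> (4 * \<eta> + 2 * q) / c"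
    using y_low p\<theta> c unfolding h_int by (intro divide_right_mono) auto
  also have "\<dots> \<le> (4 * \<eta> + 2 * (2 * \<eta> / (1 - \<alpha>))) / c"
    using q_le c by (intro divide_right_mono) auto
  finally have u_int: "(\<integral>t. \<bar>u t\<bar> * V t \<partial>M) \<le> (4 + 4 / (1 - \<alpha>)) / c * \<eta>"
    by (simp add: algebra_simps)
  have abs_int: "(\<integral>t. \<bar>z t + u t\<bar> * V t \<partial>M) \<le> q + (\<integral>t. \<bar>u t\<bar> * V t \<partial>M)"
  proof -
    have "(\<integral>t. \<bar>z t + u t\<bar> * V t \<partial>M) \<le> (\<integral>t. \<bar>z t\<bar> * V t + \<bar>u t\<bar> * V t \<partial>M)"
    proof (rule integral_mono)
      show "integrable M (\<lambda>t. \<bar>z t + u t\<bar> * V t)"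
        using zi ui by (intro integrable_abs_V) (simp add: distrib_right)
      show "\<bar>z t + u t\<bar> * V t \<le> \<bar>z t\<bar> * V t + \<bar>u t\<bar> * V t" for t
        using V_pos[of t] by (simp flip: distrib_right)
    qed (use integrable_abs_V[OF zi] integrable_abs_V[OF ui] in auto)
    also have "\<dots> = q + (\<integral>t. \<bar>u t\<bar> * V t \<partial>M)"
      using integrable_abs_V[OF zi] integrable_abs_V[OF ui] by (simp add: q_def)
    finally show ?thesis .
  qed
  have "split_le (\<lambda>t. f t - \<theta> * (indicator A t / W t)) (1 + (1 + (4 + 4 / (1 - \<alpha>)) / c) * \<eta>)"
  proof (rule split_leI[where z = "\<lambda>t. z t + u t" and p = p])
    show "AE t in M. \<bar>f t - \<theta> * (indicator A t / W t) - (z t + u t)\<bar> * W t \<le> p"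
      using py
    proof eventually_elim
      case (elim t)
      then show ?case
        using p0 by (cases "t \<in> A") (auto simp: u_def y_def)
    qed
    show "AE t in M. t \<notin> \<Gamma> \<longrightarrow> z t + u t = 0"
      using z0 by eventually_elim (use A\<Gamma> in \<open>auto simp: u_def indicator_def\<close>)
    show "integrable M (\<lambda>t. (z t + u t) * V t)"
      using zi ui by (simp add: distrib_right)
    show "p + (\<integral>t. \<bar>z t + u t\<bar> * V t \<partial>M) \<le> 1 + (1 + (4 + 4 / (1 - \<alpha>)) / c) * \<eta>"
      using abs_int u_int r unfolding q_def[symmetric] distrib_right[of 1] by simp
  qed (use p0 in auto)
  then show ?thesis
    unfolding \<theta>_def by (rule N_le)
qed

end

text \<open>Truncating both the set, along a sequence of sets of finite measure, and the function, at height \<open>n\<close>, gives finite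
  integrals that increase to the full one.\<close>

lemma (in sigma_finite_measure) exists_set_finite_integral:
  fixes h :: "'a \<Rightarrow> real"
  assumes [measurable]: "h \<in> borel_measurable M" "C \<in> sets M"
    and b: "b < (\<integral>\<^sup>+t. ennreal (h t) * indicator C t \<partial>M)"
  obtains A where "A \<in> sets M" "A \<subseteq> C" "b < (\<integral>\<^sup>+t. ennreal (h t) * indicator A t \<partial>M)"
    "(\<integral>\<^sup>+t. ennreal (h t) * indicator A t \<partial>M) < \<infinity>"
proof -
  obtain S :: "nat \<Rightarrow> 'a set" where S: "range S \<subseteq> sets M" "(\<Union>n. S n) = space M"
    "\<And>n. emeasure M (S n) \<noteq> \<infinity>" "incseq S"
    using sigma_finite_incseq by blast
  have [measurable]: "S n \<in> sets M" for n
    using S(1) by auto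
  define A where "A n = {t \<in> C \<inter> S n. h t \<le> real n}" for n
  have A_eq: "A n = C \<inter> S n \<inter> {t \<in> space M. h t \<le> real n}" for n
    using sets.sets_into_space[of C M] by (auto simp: A_def)
  have [measurable]: "A n \<in> sets M" for n
    unfolding A_eq by measurable
  have A_mono: "incseq A"
    using S(4) by (force simp: A_def incseq_def)
  have "(SUP n. ennreal (h t) * indicator (A n) t) = ennreal (h t) * indicator C t" if "t \<in> space M" for t
  proof (rule antisym)
    show "(SUP n. ennreal (h t) * indicator (A n) t) \<le> ennreal (h t) * indicator C t"
      by (rule SUP_least) (auto simp: A_def split: split_indicator)
    show "ennreal (h t) * indicator C t \<le> (SUP n. ennreal (h t) * indicator (A n) t)"
    proof (cases "t \<in> C")
      case True
      obtain k where k: "t \<in> S k"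
        using S(2) \<open>t \<in> space M\<close> by auto
      obtain l :: nat where l: "h t \<le> real l"
        using real_arch_simple by blast
      have "S k \<subseteq> S (max k l)"
        using S(4) by (simp add: incseqD)
      then have "t \<in> A (max k l)"
        using k l True by (auto simp: A_def max_def)
      then show ?thesis
        using True by (intro SUP_upper2[of "max k l"]) auto
    qed simp
  qed
  then have "(\<integral>\<^sup>+t. ennreal (h t) * indicator C t \<partial>M) =
      (\<integral>\<^sup>+t. (SUP n. ennreal (h t) * indicator (A n) t) \<partial>M)"
    by (intro nn_integral_cong) simp
  also have "\<dots> = (SUP n. \<integral>\<^sup>+t. ennreal (h t) * indicator (A n) t \<partial>M)"
    using A_mono by (intro nn_integral_monotone_convergence_SUP)
      (auto simp: incseq_def le_fun_def split: split_indicator)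
  finally obtain n where n: "b < (\<integral>\<^sup>+t. ennreal (h t) * indicator (A n) t \<partial>M)"
    using b by (auto simp: less_SUP_iff)
  have "(\<integral>\<^sup>+t. ennreal (h t) * indicator (A n) t \<partial>M) \<le> (\<integral>\<^sup>+t. ennreal (real n) * indicator (S n) t \<partial>M)"
    by (intro nn_integral_mono) (auto simp: A_def intro!: ennreal_leI split: split_indicator simp del: ennreal_of_nat_eq_real_of_nat)
  also have "\<dots> = ennreal (real n) * emeasure M (S n)"
    by (rule nn_integral_cmult_indicator) measurable
  also have "\<dots> < \<infinity>"
    using S(3)[of n] by (simp add: ennreal_mult_less_top less_top)
  finally have fin: "(\<integral>\<^sup>+t. ennreal (h t) * indicator (A n) t \<partial>M) < \<infinity>" .
  show thesis
    by (rule that[OF _ _ n fin]) (auto simp: A_def)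
qed

context weighted_sum
begin

text \<open>For the functional \<open>\<phi>\<close> given by \<open>g\<close> and for \<open>e = 1\<^sub>A / W\<close>, the operator \<open>T = - \<phi> \<otimes> e\<close> has norm at least \<open>s = \<parallel>e\<parallel>\<close>. On the part of the
  unit ball where \<open>\<bar>\<phi>\<bar>\<close> is close to one, the norm of \<open>f + T f\<close> is at most slightly above one by the slice estimate; elsewhere the triangle
  inequality alone keeps it below \<open>1 + s\<close>.\<close>

lemma slice_not_daugavet:
  assumes g[measurable]: "g \<in> borel_measurable M" and g0: "\<And>t. 0 \<le> g t"
    and gi: "integrable M (\<lambda>t. g t / W t)" and g1: "(\<integral>t. g t / W t \<partial>M) = 1"
    and gV: "AE t in M. t \<in> \<Gamma> \<longrightarrow> g t \<le> \<alpha> * V t" and \<alpha>: "0 \<le> \<alpha>" "\<alpha> < 1"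
    and A[measurable]: "A \<in> sets M" and A\<Gamma>: "A \<subseteq> \<Gamma>" and A_pos: "0 < emeasure M A"
    and c: "0 < c" and cA: "\<And>t. t \<in> A \<Longrightarrow> c * V t \<le> g t"
  shows "\<not> daugavet_property X"
proof
  assume daugavet: "daugavet_property X"
  define \<phi> where "\<phi> f = (\<integral>t. f t * g t \<partial>M)" for f
  define e where "e t = (indicator A t / W t :: real)" for t
  have e_meas[measurable]: "e \<in> borel_measurable M"
    unfolding e_def by measurable
  have \<phi>_int: "integrable M (\<lambda>t. f t * g t)" and \<phi>_le: "\<bar>\<phi> f\<bar> \<le> N f" if "sum_fun f" for f
    using functional_bound_N[OF g g0 gi g1 gV \<alpha>(1) _ that] \<alpha>(2) by (auto simp: \<phi>_def)
  have \<phi>_add: "\<phi> (\<lambda>t. f t + h t) = \<phi> f + \<phi> h" if "sum_fun f" "sum_fun h" for f h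
    unfolding \<phi>_def using \<phi>_int[OF that(1)] \<phi>_int[OF that(2)] by (simp add: distrib_right)
  have \<phi>_scale: "\<phi> (\<lambda>t. k * f t) = k * \<phi> f" for f k
    unfolding \<phi>_def by (simp add: mult.assoc)

  have one_split: "split_le (\<lambda>t. 1 / W t) 1"
    using W_pos by (intro split_le_of_bounded) auto
  then have one: "sum_fun (\<lambda>t. 1 / W t)" and N_one: "N (\<lambda>t. 1 / W t) \<le> 1"
    by (auto simp: sum_fun_def intro: N_le)
  have \<phi>_one: "\<phi> (\<lambda>t. 1 / W t) = 1"
    using g1 by (simp add: \<phi>_def)

  have "split_le e 1"
    unfolding e_def using W_pos by (intro split_le_of_bounded) (auto simp: abs_mult split: split_indicator)
  then have e: "sum_fun e"
    by (auto simp: sum_fun_def)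
  define s where "s = N e"
  have \<phi>_e: "0 < \<phi> e"
  proof -
    have nonneg: "0 \<le> e t * g t" for t
      using g0[of t] W_pos[of t] by (simp add: e_def)
    have "\<phi> e \<noteq> 0"
    proof
      assume "\<phi> e = 0"
      then have "AE t in M. e t * g t = 0"
        using integral_nonneg_eq_0_iff_AE[OF \<phi>_int[OF e]] nonneg by (simp add: \<phi>_def)
      moreover have "e t * g t \<noteq> 0" if "t \<in> A" for t
      proof -
        have "0 < g t"
          using cA[OF that] mult_pos_pos[OF c V_pos[of t]] by linarith
        then show ?thesis
          using that W_pos[of t] by (simp add: e_def)
      qed
      ultimately have "AE t in M. t \<notin> A"
        by (auto elim!: eventually_mono)
      then show False
        using A_pos AE_iff_measurable[OF A, of "\<lambda>t. t \<notin> A"] sets.sets_into_space[OF A]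
        by (auto simp: Int_absorb1 Collect_conj_eq)
    qed
    moreover have "0 \<le> \<phi> e"
      unfolding \<phi>_def using nonneg by (intro integral_nonneg_AE) auto
    ultimately show ?thesis
      by simp
  qed
  have s_pos: "0 < s"
    using \<phi>_e \<phi>_le[OF e] by (simp add: s_def)

  \<comment> \<open>The functional is evaluated at an arbitrary representative, which may take infinite values on a null set.\<close>
  define T where "T x = real_class M (\<lambda>t. - (\<integral>t. real_of_ereal ((SOME f. f \<in> x) t) * g t \<partial>M) * e t)" for x
  have T_class: "T (real_class M f) = real_class M (\<lambda>t. - \<phi> f * e t)" if f: "sum_fun f" for f
  proof -
    have [measurable]: "f \<in> borel_measurable M"
      using f by (rule sum_fun_measurable)
    define f' where "f' = (SOME f'. f' \<in> real_class M f)"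
    have "(\<lambda>t. ereal (f t)) \<in> real_class M f"
      by (simp add: real_class_def ae_eq_def)
    then have "f' \<in> real_class M f"
      unfolding f'_def by (rule someI[of "\<lambda>f'. f' \<in> real_class M f"])
    then have [measurable]: "f' \<in> borel_measurable M" and "AE t in M. ereal (f t) = f' t"
      by (auto simp: real_class_def ae_eq_def)
    then have "(\<integral>t. real_of_ereal (f' t) * g t \<partial>M) = (\<integral>t. f t * g t \<partial>M)"
    proof (intro integral_cong_AE)
      show "AE t in M. real_of_ereal (f' t) * g t = f t * g t"
        using \<open>AE t in M. ereal (f t) = f' t\<close> by eventually_elim (metis real_of_ereal.simps(1))
    qed measurable
    then show ?thesis
      by (simp add: T_def \<phi>_def f'_def)
  qed
  have Te: "sum_fun (\<lambda>t. k * e t)" "N (\<lambda>t. k * e t) = \<bar>k\<bar> * s" for k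
    using sum_fun_scale[OF e] N_scale[OF e] by (auto simp: s_def)
  have T_norm: "vnorm X (T (real_class M f)) = \<bar>\<phi> f\<bar> * s" if "sum_fun f" for f
    using that X_norm[OF Te(1), of "- \<phi> f"] Te(2)[of "- \<phi> f"] by (simp add: T_class)
  have bounded: "bounded_operator X T"
    unfolding bounded_operator_def
  proof (intro conjI ballI allI exI)
    show "T x \<in> carrier X" if "x \<in> carrier X" for x
    proof -
      from that obtain f where f: "sum_fun f" "x = real_class M f"
        by (auto simp: X_carrier_iff)
      show ?thesis
        unfolding f(2) T_class[OF f(1)] X_carrier_iff using Te(1) by blast
    qed
    show "T (vadd X x y) = vadd X (T x) (T y)" if "x \<in> carrier X" "y \<in> carrier X" for x y
    proof -
      from that obtain f h where fh: "sum_fun f" "sum_fun h" and xy: "x = real_class M f" "y = real_class M h"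
        by (auto simp: X_carrier_iff)
      then show ?thesis
        using sum_fun_add[OF fh]
        by (simp add: xy T_class X_add sum_fun_measurable \<phi>_add) (simp add: algebra_simps)
    qed
    show "T (vscale X k x) = vscale X k (T x)" if "x \<in> carrier X" for k x
    proof -
      from that obtain f where f: "sum_fun f" and x: "x = real_class M f"
        by (auto simp: X_carrier_iff)
      then show ?thesis
        using sum_fun_scale[OF f, of k]
        by (simp add: T_class X_scale sum_fun_measurable \<phi>_scale mult.assoc)
    qed
    show "vnorm X (T x) \<le> s * vnorm X x" if "x \<in> carrier X" for x
    proof -
      from that obtain f where f: "sum_fun f" and x: "x = real_class M f"
        by (auto simp: X_carrier_iff)
      show ?thesis
        using mult_right_mono[OF \<phi>_le[OF f], of s] s_pos
        by (simp add: x T_norm[OF f] X_norm[OF f] mult.commute)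
    qed
  qed
  have "rank_one X T"
    unfolding rank_one_def
  proof (intro bexI conjI)
    show "real_class M e \<in> carrier X"
      using e by (auto simp: X_carrier_iff)
    show "real_class M e \<noteq> vzero X"
    proof
      assume "real_class M e = vzero X"
      then have "AE t in M. e t = 0"
        by (simp add: X_zero real_class_eq_iff)
      then have "\<phi> e = (\<integral>t. 0 \<partial>M)"
        unfolding \<phi>_def by (intro integral_cong_AE) (auto elim: eventually_mono)
      then show False
        using \<phi>_e by simp
    qed
    show "T ` carrier X = range (\<lambda>k. vscale X k (real_class M e))"
    proof (intro equalityI subsetI)
      fix y assume "y \<in> T ` carrier X"
      then obtain f where "sum_fun f" "y = T (real_class M f)"
        by (auto simp: X_carrier_iff)
      then show "y \<in> range (\<lambda>k. vscale X k (real_class M e))"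
        by (auto simp: T_class X_scale intro!: range_eqI[of _ _ "- \<phi> f"])
    next
      fix y assume "y \<in> range (\<lambda>k. vscale X k (real_class M e))"
      then obtain k where y: "y = vscale X k (real_class M e)"
        by auto
      have f: "sum_fun (\<lambda>t. (- k) * (1 / W t))"
        using one by (rule sum_fun_scale)
      have "T (real_class M (\<lambda>t. (- k) * (1 / W t))) = y"
        unfolding T_class[OF f] \<phi>_scale \<phi>_one by (simp add: y X_scale)
      moreover have "real_class M (\<lambda>t. (- k) * (1 / W t)) \<in> carrier X"
        using f by (auto simp: X_carrier_iff)
      ultimately show "y \<in> T ` carrier X"
        by (intro image_eqI[where x = "real_class M (\<lambda>t. (- k) * (1 / W t))"]) simp_all
    qed
  qed
  with daugavet bounded have eq: "operator_norm X (\<lambda>x. vadd X x (T x)) = 1 + operator_norm X T"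
    by (auto simp: daugavet_property_def)

  have one_ball: "real_class M (\<lambda>t. 1 / W t) \<in> {x \<in> carrier X. vnorm X x \<le> 1}"
    using one N_one X_norm[OF one] by (auto simp: X_carrier_iff)
  have T_ge: "s \<le> operator_norm X T"
    unfolding operator_norm_def
  proof (rule cSUP_upper2[OF _ one_ball])
    show "s \<le> vnorm X (T (real_class M (\<lambda>t. 1 / W t)))"
      by (simp add: T_norm[OF one] \<phi>_one)
    show "bdd_above ((\<lambda>x. vnorm X (T x)) ` {x \<in> carrier X. vnorm X x \<le> 1})"
    proof (rule bdd_aboveI2)
      fix x assume "x \<in> {x \<in> carrier X. vnorm X x \<le> 1}"
      then obtain f where f: "sum_fun f" "x = real_class M f" "N f \<le> 1"
        by (auto simp: X_carrier_iff X_norm)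
      then have "\<bar>\<phi> f\<bar> * s \<le> 1 * s"
        using \<phi>_le[OF f(1)] s_pos by (intro mult_right_mono) auto
      then show "vnorm X (T x) \<le> s"
        using f by (simp add: T_norm)
    qed
  qed

  define K where "K = 1 + (4 + 4 / (1 - \<alpha>)) / c"
  have K1: "1 \<le> K"
    using \<alpha> c by (simp add: K_def)
  \<comment> \<open>The slice is so thin that the error \<open>K \<eta>\<close> of the slice estimate is half of \<open>s\<close>.\<close>
  define \<eta> where "\<eta> = s / (2 * K)"
  have \<eta>: "0 < \<eta>"
    using s_pos K1 by (simp add: \<eta>_def)
  have K\<eta>: "K * \<eta> = s / 2"
    using K1 by (simp add: \<eta>_def)
  have slice: "N (\<lambda>t. f t - \<phi> f * e t) \<le> 1 + s / 2" if f: "sum_fun f" "N f \<le> 1" "1 - \<eta> \<le> \<phi> f" for f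
  proof -
    have "split_le f (1 + \<eta>)"
      using f \<eta> by (intro split_le_gt_N) auto
    from slice_estimate[OF g g0 gi g1 gV \<alpha> A A\<Gamma> c cA sum_fun_measurable[OF f(1)] this \<eta>] f(3)
    show ?thesis
      unfolding K_def[symmetric] K\<eta> \<phi>_def e_def by simp
  qed
  define B where "B = max (1 + s / 2) (1 + (1 - \<eta>) * s)"
  have upper: "N (\<lambda>t. f t - \<phi> f * e t) \<le> B" if f: "sum_fun f" "N f \<le> 1" for f
  proof -
    consider "1 - \<eta> \<le> \<phi> f" | "1 - \<eta> \<le> - \<phi> f" | "\<bar>\<phi> f\<bar> \<le> 1 - \<eta>"
      by linarith
    then show ?thesis
    proof cases
      case 1
      then show ?thesis
        using slice[OF f] by (simp add: B_def)
    next
      case 2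
      have f': "sum_fun (\<lambda>t. - 1 * f t)" "N (\<lambda>t. - 1 * f t) \<le> 1" "\<phi> (\<lambda>t. - 1 * f t) = - \<phi> f"
        using f sum_fun_scale[OF f(1), of "- 1"] N_scale[OF f(1), of "- 1"] \<phi>_scale[of "- 1" f] by auto
      have F: "sum_fun (\<lambda>t. f t + (- \<phi> f) * e t)"
        by (intro sum_fun_add f Te)
      have "N (\<lambda>t. - 1 * f t - (- \<phi> f) * e t) \<le> 1 + s / 2"
        using slice[OF f'(1,2)] 2 unfolding f'(3) by simp
      moreover have "(\<lambda>t. - 1 * f t - (- \<phi> f) * e t) = (\<lambda>t. - 1 * (f t + (- \<phi> f) * e t))"
        by auto
      ultimately have "N (\<lambda>t. f t + (- \<phi> f) * e t) \<le> 1 + s / 2"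
        using N_scale[OF F, of "- 1"] by simp
      then show ?thesis
        by (simp add: B_def)
    next
      case 3
      have "N (\<lambda>t. f t + (- \<phi> f) * e t) \<le> N f + \<bar>\<phi> f\<bar> * s"
        using N_triangle[OF f(1) Te(1)[of "- \<phi> f"]] Te(2)[of "- \<phi> f"] by simp
      also have "\<dots> \<le> 1 + (1 - \<eta>) * s"
        using f(2) 3 s_pos by (intro add_mono mult_right_mono) auto
      finally show ?thesis
        by (simp add: B_def)
    qed
  qed
  have "operator_norm X (\<lambda>x. vadd X x (T x)) \<le> B"
    unfolding operator_norm_def
  proof (rule cSUP_least)
    show "{x \<in> carrier X. vnorm X x \<le> 1} \<noteq> {}"
      using one_ball by blast
    fix x assume "x \<in> {x \<in> carrier X. vnorm X x \<le> 1}"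
    then obtain f where f: "sum_fun f" "x = real_class M f" "N f \<le> 1"
      by (auto simp: X_carrier_iff X_norm)
    have "vadd X x (T x) = real_class M (\<lambda>t. f t + (- \<phi> f) * e t)"
      unfolding f(2) T_class[OF f(1)] using f(1) by (intro X_add) (auto simp: sum_fun_measurable)
    then show "vnorm X (vadd X x (T x)) \<le> B"
      using upper[OF f(1,3)] X_norm[OF sum_fun_add[OF f(1) Te(1)[of "- \<phi> f"]]] by simp
  qed
  moreover have "B < 1 + s"
    using s_pos \<eta> by (simp add: B_def)
  ultimately show False
    using eq T_ge by linarith
qed

lemma exists_finite_subset_of_\<Gamma>:
  assumes "sigma_finite_measure M" and b: "b < (\<integral>\<^sup>+t. ennreal (V t / W t) * indicator \<Gamma> t \<partial>M)"
  obtains A where "A \<in> sets M" "A \<subseteq> \<Gamma>" "0 < emeasure M A"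
    "integrable M (\<lambda>t. V t / W t * indicator A t)"
    "b < ennreal (\<integral>t. V t / W t * indicator A t \<partial>M)"
proof -
  have nonneg: "0 \<le> V t / W t" for t
    using V_pos[of t] W_pos[of t] by simp
  from sigma_finite_measure.exists_set_finite_integral[OF assms(1) _ \<Gamma> b]
  obtain A where A[measurable]: "A \<in> sets M" and "A \<subseteq> \<Gamma>"
    and bA: "b < (\<integral>\<^sup>+t. ennreal (V t / W t) * indicator A t \<partial>M)"
    and fin: "(\<integral>\<^sup>+t. ennreal (V t / W t) * indicator A t \<partial>M) < \<infinity>"
    by auto
  have nonneg': "AE t in M. 0 \<le> V t / W t * indicator A t"
    using nonneg by (intro AE_I2 mult_nonneg_nonneg) auto
  have eq: "(\<integral>\<^sup>+t. ennreal (V t / W t) * indicator A t \<partial>M) = (\<integral>\<^sup>+t. ennreal (V t / W t * indicator A t) \<partial>M)"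
    by (intro nn_integral_cong) (auto split: split_indicator)
  have int: "integrable M (\<lambda>t. V t / W t * indicator A t)"
    using fin nonneg' unfolding eq by (intro integrableI_nonneg) auto
  have "0 < emeasure M A"
  proof (rule ccontr)
    assume "\<not> 0 < emeasure M A"
    then have "A \<in> null_sets M"
      by (auto simp: null_sets_def)
    from AE_not_in[OF this] have "(\<integral>\<^sup>+t. ennreal (V t / W t) * indicator A t \<partial>M) = (\<integral>\<^sup>+t. 0 \<partial>M)"
      by (intro nn_integral_cong_AE) (auto elim!: eventually_mono)
    then show False
      using bA by simp
  qed
  moreover have "b < ennreal (\<integral>t. V t / W t * indicator A t \<partial>M)"
    using bA by (simp only: eq nn_integral_eq_integral[OF int nonneg'])
  ultimately show thesis
    using that A \<open>A \<subseteq> \<Gamma>\<close> int by blast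
qed

text \<open>If the complement of \<open>\<Gamma>\<close> is not null, part of the mass of \<open>g\<close> can be put there, where only bounded summands live; this
  leaves room for a factor \<open>\<alpha> < 1\<close> on \<open>\<Gamma>\<close> whatever the size of \<open>\<integral> V/W\<close>.\<close>

lemma daugavet_imp_conull:
  assumes sf: "sigma_finite_measure M" and \<Gamma>_pos: "0 < emeasure M \<Gamma>" and daugavet: "daugavet_property X"
  shows "AE t in M. t \<in> \<Gamma>"
proof (rule ccontr)
  assume "\<not> (AE t in M. t \<in> \<Gamma>)"
  then have D_pos: "0 < emeasure M (space M - \<Gamma>)"
    by (simp flip: conull_iff add: zero_less_iff_neq_zero)
  have "0 < (\<integral>\<^sup>+t. ennreal (V t / W t) * indicator \<Gamma> t \<partial>M)"
  proof (rule ccontr)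
    assume "\<not> ?thesis"
    then have "AE t in M. ennreal (V t / W t) * indicator \<Gamma> t = 0"
      by (subst (asm) not_gr_zero, subst (asm) nn_integral_0_iff_AE) auto
    then have "AE t in M. t \<notin> \<Gamma>"
    proof eventually_elim
      case (elim t)
      then show ?case
        using V_pos[of t] W_pos[of t] by (auto simp: divide_le_0_iff split: split_indicator_asm)
    qed
    then show False
      using \<Gamma>_pos AE_iff_measurable[OF \<Gamma>, of "\<lambda>t. t \<notin> \<Gamma>"] sets.sets_into_space[OF \<Gamma>]
      by (auto simp: Int_absorb1 Collect_conj_eq)
  qed
  from exists_finite_subset_of_\<Gamma>[OF sf this]
  obtain A where A[measurable]: "A \<in> sets M" and A\<Gamma>: "A \<subseteq> \<Gamma>" and A_pos: "0 < emeasure M A"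
    and Ai: "integrable M (\<lambda>t. V t / W t * indicator A t)"
    and m_pos: "0 < ennreal (\<integral>t. V t / W t * indicator A t \<partial>M)"
    by auto
  define m where "m = (\<integral>t. V t / W t * indicator A t \<partial>M)"
  have m: "0 < m"
    using m_pos by (simp add: m_def)
  have "0 < (\<integral>\<^sup>+t. ennreal 1 * indicator (space M - \<Gamma>) t \<partial>M)"
    using D_pos by simp
  from sigma_finite_measure.exists_set_finite_integral[OF sf _ _ this]
  obtain B where B[measurable]: "B \<in> sets M" and BD: "B \<subseteq> space M - \<Gamma>"
    and B_pos: "0 < emeasure M B" and B_fin: "emeasure M B < \<infinity>"
    by (auto simp: nn_integral_indicator)
  have mB: "0 < measure M B"
    using B_pos B_fin by (simp add: measure_def enn2real_positive_iff)
  \<comment> \<open>The set \<open>A\<close> carries mass \<open>\<alpha> m \<le> 1 / 2\<close> of \<open>g / W\<close>, and \<open>\<beta>\<close> puts the rest on \<open>B\<close>.\<close>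
  define \<alpha> where "\<alpha> = min (1 / 2) (1 / (2 * m))"
  have \<alpha>: "0 < \<alpha>" "\<alpha> < 1" "\<alpha> * m \<le> 1"
    using m by (auto simp: \<alpha>_def min_def field_simps)
  define \<beta> where "\<beta> = (1 - \<alpha> * m) / measure M B"
  have \<beta>: "0 \<le> \<beta>" "\<beta> * measure M B = 1 - \<alpha> * m"
    using \<alpha> mB by (auto simp: \<beta>_def)
  define g where "g t = \<alpha> * (V t * indicator A t) + \<beta> * (W t * indicator B t)" for t
  have [measurable]: "g \<in> borel_measurable M"
    unfolding g_def by measurable
  have gW: "(\<lambda>t. g t / W t) = (\<lambda>t. \<alpha> * (V t / W t * indicator A t) + \<beta> * indicator B t)"
    using W_pos by (auto simp: g_def fun_eq_iff add_divide_distrib less_imp_neq[symmetric])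
  have Bi: "integrable M (\<lambda>t. indicator B t :: real)"
    using B_fin by (intro integrable_real_indicator) auto
  have "\<not> daugavet_property X"
  proof (rule slice_not_daugavet[where g = g and \<alpha> = \<alpha> and A = A and c = \<alpha>])
    show "0 \<le> g t" for t
      using \<alpha> \<beta> V_pos[of t] W_pos[of t] by (simp add: g_def)
    show "integrable M (\<lambda>t. g t / W t)"
      unfolding gW by (intro Bochner_Integration.integrable_add integrable_mult_right Ai Bi)
    have "(\<integral>t. g t / W t \<partial>M) = \<alpha> * m + \<beta> * measure M B"
      unfolding gW m_def using Ai Bi sets.sets_into_space[OF B]
      by (subst Bochner_Integration.integral_add) (auto simp: Int_absorb1 intro: integrable_mult_right simp del: times_divide_eq_left)
    then show "(\<integral>t. g t / W t \<partial>M) = 1"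
      using \<beta> by simp
    show "AE t in M. t \<in> \<Gamma> \<longrightarrow> g t \<le> \<alpha> * V t"
      using BD \<alpha> V_pos by (intro AE_I2) (auto simp: g_def less_imp_le split: split_indicator)
    show "\<alpha> * V t \<le> g t" if "t \<in> A" for t
      using that \<beta> W_pos[of t] by (simp add: g_def)
  qed (use \<alpha> A\<Gamma> A_pos in auto)
  with daugavet show False
    by simp
qed

text \<open>On a set \<open>A\<close> with \<open>m = \<integral>\<^sub>A V/W > 1\<close> the normalized weight \<open>g = 1\<^sub>A V / m\<close> has norm one on \<open>L\<^sub>\<infinity>\<close> and norm at most
  \<open>1 / m < 1\<close> on \<open>L\<^sub>1\<close>.\<close>

lemma daugavet_imp_quotient_le:
  assumes sf: "sigma_finite_measure M" and conull: "AE t in M. t \<in> \<Gamma>" and daugavet: "daugavet_property X"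
  shows "(\<integral>\<^sup>+t. ennreal (V t / W t) \<partial>M) \<le> 1"
proof (rule ccontr)
  assume "\<not> ?thesis"
  moreover have "(\<integral>\<^sup>+t. ennreal (V t / W t) * indicator \<Gamma> t \<partial>M) = (\<integral>\<^sup>+t. ennreal (V t / W t) \<partial>M)"
    using conull by (intro nn_integral_cong_AE) (auto elim!: eventually_mono)
  ultimately have "1 < (\<integral>\<^sup>+t. ennreal (V t / W t) * indicator \<Gamma> t \<partial>M)"
    by simp
  from exists_finite_subset_of_\<Gamma>[OF sf this]
  obtain A where A[measurable]: "A \<in> sets M" and A\<Gamma>: "A \<subseteq> \<Gamma>" and A_pos: "0 < emeasure M A"
    and Ai: "integrable M (\<lambda>t. V t / W t * indicator A t)"
    and m_gt: "1 < ennreal (\<integral>t. V t / W t * indicator A t \<partial>M)"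
    by auto
  define m where "m = (\<integral>t. V t / W t * indicator A t \<partial>M)"
  have m: "1 < m"
    using m_gt by (simp add: m_def)
  define g where "g t = V t * indicator A t / m" for t
  have [measurable]: "g \<in> borel_measurable M"
    unfolding g_def by measurable
  have gW: "(\<lambda>t. g t / W t) = (\<lambda>t. V t / W t * indicator A t / m)"
    by (auto simp: g_def fun_eq_iff)
  have "\<not> daugavet_property X"
  proof (rule slice_not_daugavet[where g = g and \<alpha> = "1 / m" and A = A and c = "1 / m"])
    show "0 \<le> g t" for t
      using m V_pos[of t] by (simp add: g_def)
    show "integrable M (\<lambda>t. g t / W t)"
      unfolding gW using Ai by (rule integrable_divide)
    show "(\<integral>t. g t / W t \<partial>M) = 1"
      unfolding gW using m by (simp add: m_def[symmetric] del: times_divide_eq_left)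
    show "AE t in M. t \<in> \<Gamma> \<longrightarrow> g t \<le> 1 / m * V t"
      using m less_imp_le[OF V_pos] by (intro AE_I2) (auto simp: g_def split: split_indicator)
    show "1 / m * V t \<le> g t" if "t \<in> A" for t
      using that by (simp add: g_def)
  qed (use m A\<Gamma> A_pos in auto)
  with daugavet show False
    by simp
qed

end

section \<open>Finite covers by sets of small measure\<close>

text \<open>Only the part of a set on which the density is nonzero counts, and there null sets are the same for both measures.\<close>

lemma non_atomic_density:
  assumes na: "non_atomic M" and [measurable]: "h \<in> borel_measurable M"
  shows "non_atomic (density M h)"
  unfolding non_atomic_def
proof (intro ballI impI)
  have pos_iff: "0 < emeasure (density M h) C \<longleftrightarrow> 0 < emeasure M (C \<inter> {t \<in> space M. h t \<noteq> 0})"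
    if C[measurable]: "C \<in> sets M" for C
  proof -
    have "emeasure (density M h) C = 0 \<longleftrightarrow> (AE t in M. t \<in> C \<longrightarrow> h t = 0)"
      using null_sets_density_iff[of h M C] C by (auto simp: null_sets_def)
    also have "\<dots> \<longleftrightarrow> emeasure M (C \<inter> {t \<in> space M. h t \<noteq> 0}) = 0"
      using sets.sets_into_space[OF C] by (intro AE_iff_measurable) auto
    finally show ?thesis
      by (simp add: zero_less_iff_neq_zero)
  qed
  fix A assume "A \<in> sets (density M h)" and A_pos: "0 < emeasure (density M h) A"
  then have A[measurable]: "A \<in> sets M"
    by simp
  let ?A = "A \<inter> {t \<in> space M. h t \<noteq> 0}"
  have "0 < emeasure M ?A"
    using A_pos pos_iff[OF A] by simp
  moreover have "?A \<in> sets M"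
    by measurable
  ultimately obtain B where B[measurable]: "B \<in> sets M" and BA: "B \<subseteq> ?A"
    and pos: "0 < emeasure M B" "0 < emeasure M (?A - B)"
    using na unfolding non_atomic_def by blast
  have eqs: "B \<inter> {t \<in> space M. h t \<noteq> 0} = B" "(A - B) \<inter> {t \<in> space M. h t \<noteq> 0} = ?A - B"
    using BA by auto
  show "\<exists>B\<in>sets (density M h). B \<subseteq> A \<and> 0 < emeasure (density M h) B \<and> 0 < emeasure (density M h) (A - B)"
    using pos BA pos_iff[OF B] pos_iff[of "A - B"] unfolding eqs by (intro bexI[of _ B]) auto
qed

text \<open>Keep the smaller half of a splitting, repeatedly.\<close>

lemma (in finite_measure) exists_small_subset:
  assumes na: "non_atomic M" and A: "A \<in> sets M" "0 < measure M A" and \<delta>: "0 < \<delta>"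
  shows "\<exists>B\<in>sets M. B \<subseteq> A \<and> 0 < measure M B \<and> measure M B < \<delta>"
proof -
  have "\<exists>B\<in>sets M. B \<subseteq> A \<and> 0 < measure M B \<and> measure M B \<le> measure M A / 2 ^ n" for n
  proof (induction n)
    case 0
    then show ?case
      using A by auto
  next
    case (Suc n)
    then obtain B where B: "B \<in> sets M" "B \<subseteq> A" "0 < measure M B" "measure M B \<le> measure M A / 2 ^ n"
      by auto
    then obtain C where C: "C \<in> sets M" "C \<subseteq> B" "0 < emeasure M C" "0 < emeasure M (B - C)"
      using na unfolding non_atomic_def by (metis emeasure_eq_measure ennreal_less_zero_iff)
    have sum: "measure M B = measure M C + measure M (B - C)"
      using finite_measure_Diff[OF B(1) C(1,2)] by simp
    have pos: "0 < measure M C" "0 < measure M (B - C)"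
      using C by (auto simp: emeasure_eq_measure)
    show ?case
    proof (cases "measure M C \<le> measure M (B - C)")
      case True
      then show ?thesis
        using sum pos B C by (intro bexI[of _ C]) auto
    next
      case False
      then show ?thesis
        using sum pos B C by (intro bexI[of _ "B - C"]) auto
    qed
  qed
  moreover obtain n where "measure M A / 2 ^ n < \<delta>"
  proof -
    have "(\<lambda>n. measure M A / 2 ^ n) \<longlonglongrightarrow> 0"
      by (intro LIMSEQ_divide_realpow_zero) auto
    then have "\<forall>\<^sub>F n in sequentially. measure M A / 2 ^ n < \<delta>"
      using \<delta> by (rule order_tendstoD)
    then show thesis
      using that eventually_happens' sequentially_bot by blast
  qed
  ultimately show ?thesis
    by (meson order_le_less_trans)
qed

text \<open>Exhaustion: a finite union of small sets can be enlarged by a small set as long as its complement is not null,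
  so some such union has nearly full measure, and its complement is then small itself.\<close>

lemma (in finite_measure) exists_small_finite_cover:
  assumes na: "non_atomic M" and \<delta>: "0 < \<delta>"
  obtains \<C> where "finite \<C>" "\<C> \<subseteq> sets M" "space M \<subseteq> \<Union>\<C>" "\<And>C. C \<in> \<C> \<Longrightarrow> measure M C < \<delta>"
proof -
  define good where "good E \<longleftrightarrow> (\<exists>\<C>. finite \<C> \<and> \<C> \<subseteq> sets M \<and> E = \<Union>\<C> \<and> (\<forall>C\<in>\<C>. measure M C < \<delta>))" for E
  have good_empty: "good {}"
    unfolding good_def by (intro exI[of _ "{}"]) auto
  have good_Un: "good (E \<union> F)" if "good E" "good F" for E F
  proof -
    from that obtain \<C> \<D> where "finite \<C>" "\<C> \<subseteq> sets M" "E = \<Union>\<C>" "\<forall>C\<in>\<C>. measure M C < \<delta>"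
      "finite \<D>" "\<D> \<subseteq> sets M" "F = \<Union>\<D>" "\<forall>C\<in>\<D>. measure M C < \<delta>"
      unfolding good_def by metis
    then show ?thesis
      unfolding good_def by (intro exI[of _ "\<C> \<union> \<D>"]) auto
  qed
  have good_single: "good E" if "E \<in> sets M" "measure M E < \<delta>" for E
    unfolding good_def using that by (intro exI[of _ "{E}"]) auto
  have good_sets: "E \<in> sets M" if "good E" for E
    using that unfolding good_def by auto
  define s where "s = Sup (measure M ` Collect good)"
  have bdd: "bdd_above (measure M ` Collect good)"
    by (rule bdd_aboveI2[of _ _ "measure M (space M)"]) (rule bounded_measure)
  have le_s: "measure M E \<le> s" if "good E" for E
    unfolding s_def using that bdd by (intro cSup_upper) auto
  have "\<exists>E. good E \<and> s - 1 / real (Suc n) < measure M E" for n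
  proof -
    have "\<exists>y\<in>measure M ` Collect good. s - 1 / real (Suc n) < y"
      unfolding s_def using good_empty by (intro less_cSupD) auto
    then show ?thesis
      by auto
  qed
  then obtain E where E: "\<And>n. good (E n)" "\<And>n. s - 1 / real (Suc n) < measure M (E n)"
    by metis
  have [measurable]: "E n \<in> sets M" for n
    using E(1) good_sets by auto
  define U where "U = (\<Union>n. E n)"
  have [measurable]: "U \<in> sets M"
    unfolding U_def by measurable
  have null: "measure M (space M - U) = 0"
  proof (rule ccontr)
    assume "measure M (space M - U) \<noteq> 0"
    then have "0 < measure M (space M - U)"
      using measure_nonneg[of M "space M - U"] by linarith
    from exists_small_subset[OF na _ this \<delta>]
    obtain B where B[measurable]: "B \<in> sets M" and BU: "B \<subseteq> space M - U"
      and B_pos: "0 < measure M B" and "measure M B < \<delta>"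
      by auto
    then have goodB: "good B"
      by (intro good_single)
    obtain n where n: "1 / real (Suc n) < measure M B"
      using B_pos nat_approx_posE by blast
    have "E n \<inter> B = {}"
      using BU by (auto simp: U_def)
    then have "measure M (E n \<union> B) = measure M (E n) + measure M B"
      by (intro finite_measure_Union) auto
    then show False
      using le_s[OF good_Un[OF E(1)[of n] goodB]] E(2)[of n] n by linarith
  qed
  have good_UN: "good (\<Union>i\<le>n. E i)" for n
    by (induction n) (auto simp: atMost_Suc E(1) intro: good_Un)
  have "(\<lambda>n. measure M (space M - (\<Union>i\<le>n. E i))) \<longlonglongrightarrow> measure M (\<Inter>n. space M - (\<Union>i\<le>n. E i))"
    by (rule finite_Lim_measure_decseq) (auto simp: decseq_def intro: order_trans)
  also have "(\<Inter>n. space M - (\<Union>i\<le>n. E i)) = space M - U"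
    by (auto simp: U_def)
  finally have "\<forall>\<^sub>F n in sequentially. measure M (space M - (\<Union>i\<le>n. E i)) < \<delta>"
    using \<delta> unfolding null by (rule order_tendstoD)
  then obtain n where "measure M (space M - (\<Union>i\<le>n. E i)) < \<delta>"
    using eventually_happens' sequentially_bot by blast
  then have "good ((\<Union>i\<le>n. E i) \<union> (space M - (\<Union>i\<le>n. E i)))"
    by (intro good_Un good_UN good_single) auto
  then show thesis
    unfolding good_def using that by (metis Un_Diff_cancel Un_upper2)
qed

section \<open>The Daugavet property of a weighted \<open>L\<^sub>1\<close>\<close>

text \<open>The quantity \<open>\<phi> f - c \<parallel>f\<parallel>\<close> is additive over disjoint restrictions of \<open>f\<close>, because the \<open>L\<^sub>1\<close> norm is; if it is positive
  for \<open>f\<close>, it is positive for the restriction of \<open>f\<close> to a part of some member of the cover.\<close>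

lemma concentrate_functional:
  fixes V :: "'a \<Rightarrow> real" and \<phi> :: "('a \<Rightarrow> real) \<Rightarrow> real"
  assumes [measurable]: "V \<in> borel_measurable M" and V: "\<And>t. 0 < V t"
    and add: "\<And>f g. \<lbrakk>f \<in> borel_measurable M; integrable M (\<lambda>t. f t * V t);
      g \<in> borel_measurable M; integrable M (\<lambda>t. g t * V t)\<rbrakk> \<Longrightarrow> \<phi> (\<lambda>t. f t + g t) = \<phi> f + \<phi> g"
    and bound: "\<And>f. \<lbrakk>f \<in> borel_measurable M; integrable M (\<lambda>t. f t * V t)\<rbrakk> \<Longrightarrow>
      \<bar>\<phi> f\<bar> \<le> K * (\<integral>t. \<bar>f t\<bar> * V t \<partial>M)"
    and "finite \<C>" "\<C> \<subseteq> sets M"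
    and "f \<in> borel_measurable M" "integrable M (\<lambda>t. f t * V t)"
    and "\<And>t. t \<in> space M \<Longrightarrow> t \<notin> \<Union>\<C> \<Longrightarrow> f t = 0"
    and "c * (\<integral>t. \<bar>f t\<bar> * V t \<partial>M) < \<phi> f"
  shows "\<exists>C\<in>\<C>. \<exists>g. g \<in> borel_measurable M \<and> integrable M (\<lambda>t. g t * V t) \<and>
    (\<forall>t. t \<notin> C \<longrightarrow> g t = 0) \<and> c * (\<integral>t. \<bar>g t\<bar> * V t \<partial>M) < \<phi> g"
  using assms(5-)
proof (induction \<C> arbitrary: f rule: finite_induct)
  case empty
  have "(\<integral>t. \<bar>f t\<bar> * V t \<partial>M) = (\<integral>t. 0 \<partial>M)"
    using empty.prems(4) by (intro Bochner_Integration.integral_cong) auto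
  then show ?case
    using bound[OF empty.prems(2,3)] empty.prems(5) by simp
next
  case (insert C \<C>)
  note [measurable] = insert.prems(2)
  have [measurable]: "C \<in> sets M"
    using insert.prems(1) by simp
  have part: "integrable M (\<lambda>t. f t * s t * V t)"
    if [measurable]: "s \<in> borel_measurable M" and s: "\<And>t. \<bar>s t\<bar> \<le> 1" for s :: "'a \<Rightarrow> real"
  proof (rule Bochner_Integration.integrable_bound[OF insert.prems(3)])
    have "\<bar>f t * V t\<bar> * \<bar>s t\<bar> \<le> \<bar>f t * V t\<bar>" for t
      using s[of t] by (intro mult_right_le_one_le) auto
    then show "AE t in M. norm (f t * s t * V t) \<le> norm (f t * V t)"
      by (auto simp: abs_mult ac_simps)
  qed measurable
  let ?g = "\<lambda>t. f t * indicator C t" and ?h = "\<lambda>t. f t * (1 - indicator C t)"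
  have g: "integrable M (\<lambda>t. ?g t * V t)" and h: "integrable M (\<lambda>t. ?h t * V t)"
    by (rule part; auto split: split_indicator)+
  have abs: "integrable M (\<lambda>t. \<bar>?g t\<bar> * V t)" "integrable M (\<lambda>t. \<bar>?h t\<bar> * V t)"
    using integrable_abs[OF g] integrable_abs[OF h] by (simp_all add: abs_mult abs_of_pos[OF V])
  have f_eq: "f = (\<lambda>t. ?g t + ?h t)"
    by (simp add: fun_eq_iff algebra_simps)
  have \<phi>f: "\<phi> f = \<phi> ?g + \<phi> ?h"
    by (subst f_eq, rule add) (use g h in auto)
  have "(\<integral>t. \<bar>f t\<bar> * V t \<partial>M) = (\<integral>t. \<bar>?g t\<bar> * V t + \<bar>?h t\<bar> * V t \<partial>M)"
    by (intro Bochner_Integration.integral_cong) (auto split: split_indicator)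
  also have "\<dots> = (\<integral>t. \<bar>?g t\<bar> * V t \<partial>M) + (\<integral>t. \<bar>?h t\<bar> * V t \<partial>M)"
    using abs by (rule Bochner_Integration.integral_add)
  finally have "c * (\<integral>t. \<bar>?g t\<bar> * V t \<partial>M) + c * (\<integral>t. \<bar>?h t\<bar> * V t \<partial>M) < \<phi> ?g + \<phi> ?h"
    using insert.prems(5) \<phi>f by (simp add: distrib_left)
  then consider "c * (\<integral>t. \<bar>?g t\<bar> * V t \<partial>M) < \<phi> ?g" | "c * (\<integral>t. \<bar>?h t\<bar> * V t \<partial>M) < \<phi> ?h"
    by linarith
  then show ?case
  proof cases
    case 1
    then show ?thesis
      using g by (intro bexI[of _ C] exI[of _ ?g]) auto
  next
    case 2
    have "\<exists>C\<in>\<C>. \<exists>g. g \<in> borel_measurable M \<and> integrable M (\<lambda>t. g t * V t) \<and>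
        (\<forall>t. t \<notin> C \<longrightarrow> g t = 0) \<and> c * (\<integral>t. \<bar>g t\<bar> * V t \<partial>M) < \<phi> g"
      using insert.prems(1,4) h 2 by (intro insert.IH[of ?h]) (auto split: split_indicator)
    then show ?thesis
      by blast
  qed
qed

text \<open>The cover is chosen so fine that \<open>a\<close> has norm less than \<open>\<delta>\<close> on each member. A normalized function \<open>g\<close> that lives on one
  member is then nearly disjoint from \<open>a\<close>, so the norm of \<open>g + \<phi>(g) a\<close> is nearly \<open>1 + \<phi>(g) \<parallel>a\<parallel>\<close>, whereas \<open>\<phi>(g)\<close> is still
  above any given nonnegative value that \<open>\<phi>\<close> exceeds on the unit ball.\<close>

lemma L1_daugavet_estimate:
  fixes V :: "'a \<Rightarrow> real" and \<phi> :: "('a \<Rightarrow> real) \<Rightarrow> real"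
  assumes na: "non_atomic M" and [measurable]: "V \<in> borel_measurable M" and V: "\<And>t. 0 < V t"
    and add: "\<And>f g. \<lbrakk>f \<in> borel_measurable M; integrable M (\<lambda>t. f t * V t);
      g \<in> borel_measurable M; integrable M (\<lambda>t. g t * V t)\<rbrakk> \<Longrightarrow> \<phi> (\<lambda>t. f t + g t) = \<phi> f + \<phi> g"
    and scale: "\<And>k f. \<lbrakk>f \<in> borel_measurable M; integrable M (\<lambda>t. f t * V t)\<rbrakk> \<Longrightarrow>
      \<phi> (\<lambda>t. k * f t) = k * \<phi> f"
    and bound: "\<And>f. \<lbrakk>f \<in> borel_measurable M; integrable M (\<lambda>t. f t * V t)\<rbrakk> \<Longrightarrow>
      \<bar>\<phi> f\<bar> \<le> K * (\<integral>t. \<bar>f t\<bar> * V t \<partial>M)"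
    and a[measurable]: "a \<in> borel_measurable M" and ai: "integrable M (\<lambda>t. a t * V t)"
    and f[measurable]: "f \<in> borel_measurable M" and fi: "integrable M (\<lambda>t. f t * V t)"
    and f1: "(\<integral>t. \<bar>f t\<bar> * V t \<partial>M) \<le> 1" and c: "0 \<le> c" "c < \<phi> f" and \<delta>: "0 < \<delta>"
  obtains g where "g \<in> borel_measurable M" "integrable M (\<lambda>t. g t * V t)" "(\<integral>t. \<bar>g t\<bar> * V t \<partial>M) = 1"
    "c < \<phi> g" "1 + \<phi> g * ((\<integral>t. \<bar>a t\<bar> * V t \<partial>M) - 2 * \<delta>) \<le> (\<integral>t. \<bar>g t + \<phi> g * a t\<bar> * V t \<partial>M)"
proof -
  have abs_int: "integrable M (\<lambda>t. \<bar>h t\<bar> * V t)" if "integrable M (\<lambda>t. h t * V t)" for h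
    using integrable_abs[OF that] by (simp add: abs_mult abs_of_pos[OF V])
  define D where "D = density M (\<lambda>t. ennreal (\<bar>a t\<bar> * V t))"
  have D_emeasure: "emeasure D C = ennreal (\<integral>t. \<bar>a t\<bar> * V t * indicator C t \<partial>M)"
    and aC: "integrable M (\<lambda>t. \<bar>a t\<bar> * V t * indicator C t)" if [measurable]: "C \<in> sets M" for C
  proof -
    have nonneg: "AE t in M. 0 \<le> \<bar>a t\<bar> * V t * indicator C t"
      using less_imp_le[OF V] by auto
    show int: "integrable M (\<lambda>t. \<bar>a t\<bar> * V t * indicator C t)"
      by (rule integrable_real_mult_indicator[OF that abs_int[OF ai]])
    have "emeasure D C = (\<integral>\<^sup>+t. ennreal (\<bar>a t\<bar> * V t) * indicator C t \<partial>M)"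
      unfolding D_def by (rule emeasure_density) measurable
    also have "\<dots> = (\<integral>\<^sup>+t. ennreal (\<bar>a t\<bar> * V t * indicator C t) \<partial>M)"
      by (intro nn_integral_cong) (auto split: split_indicator)
    finally show "emeasure D C = ennreal (\<integral>t. \<bar>a t\<bar> * V t * indicator C t \<partial>M)"
      by (simp only: nn_integral_eq_integral[OF int nonneg])
  qed
  have D_sets: "sets D = sets M" "space D = space M"
    by (simp_all add: D_def)
  have fin: "finite_measure D"
    by (rule finite_measureI) (simp add: D_sets D_emeasure)
  have "non_atomic D"
    unfolding D_def by (rule non_atomic_density[OF na]) measurable
  from finite_measure.exists_small_finite_cover[OF fin this \<delta>]
  obtain \<C> where \<C>: "finite \<C>" "\<C> \<subseteq> sets M" "space M \<subseteq> \<Union>\<C>" "\<And>C. C \<in> \<C> \<Longrightarrow> measure D C < \<delta>"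
    unfolding D_sets by blast
  have cf: "c * (\<integral>t. \<bar>f t\<bar> * V t \<partial>M) < \<phi> f"
    using mult_left_mono[OF f1 c(1)] c(2) by simp
  have "\<exists>C\<in>\<C>. \<exists>h. h \<in> borel_measurable M \<and> integrable M (\<lambda>t. h t * V t) \<and>
      (\<forall>t. t \<notin> C \<longrightarrow> h t = 0) \<and> c * (\<integral>t. \<bar>h t\<bar> * V t \<partial>M) < \<phi> h"
  proof (rule concentrate_functional[where \<phi> = \<phi> and K = K, OF assms(2) V _ _ \<C>(1,2) f fi _ cf])
    show "f t = 0" if "t \<in> space M" "t \<notin> \<Union>\<C>" for t
      using that \<C>(3) by auto
  qed (fact add bound)+
  then obtain C h where C: "C \<in> \<C>" and h[measurable]: "h \<in> borel_measurable M"
    and hi: "integrable M (\<lambda>t. h t * V t)" and h0: "\<And>t. t \<notin> C \<Longrightarrow> h t = 0"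
    and ch: "c * (\<integral>t. \<bar>h t\<bar> * V t \<partial>M) < \<phi> h"
    by blast
  have [measurable]: "C \<in> sets M"
    using C \<C>(2) by auto
  define m where "m = (\<integral>t. \<bar>h t\<bar> * V t \<partial>M)"
  have "0 \<le> m"
    unfolding m_def using less_imp_le[OF V] by (intro integral_nonneg_AE) auto
  moreover have "m \<noteq> 0"
    using ch bound[OF h hi] by (auto simp: m_def)
  ultimately have m: "0 < m"
    by simp
  define g where "g t = inverse m * h t" for t
  have [measurable]: "g \<in> borel_measurable M"
    unfolding g_def by measurable
  have gi: "integrable M (\<lambda>t. g t * V t)"
    using hi by (simp add: g_def mult.assoc)
  have g1: "(\<integral>t. \<bar>g t\<bar> * V t \<partial>M) = 1"
    using m by (simp add: g_def abs_mult mult.assoc m_def[symmetric])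
  have \<phi>g: "\<phi> g = inverse m * \<phi> h"
    unfolding g_def by (rule scale[OF h hi])
  have c\<phi>: "c < \<phi> g"
    using ch m unfolding \<phi>g m_def[symmetric] by (simp add: field_simps)
  define \<theta> where "\<theta> = \<phi> g"
  have \<theta>: "0 \<le> \<theta>"
    using c\<phi> c by (simp add: \<theta>_def)
  have "measure D C = (\<integral>t. \<bar>a t\<bar> * V t * indicator C t \<partial>M)"
    using D_emeasure[of C] less_imp_le[OF V] by (simp add: measure_def integral_nonneg_AE)
  then have small: "(\<integral>t. \<bar>a t\<bar> * V t * indicator C t \<partial>M) \<le> \<delta>"
    using \<C>(4)[OF C] by simp
  have sum_int: "integrable M (\<lambda>t. (g t + \<theta> * a t) * V t)"
    using gi ai by (simp add: distrib_right mult.assoc)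
  let ?l = "\<lambda>t. \<bar>g t\<bar> * V t + \<theta> * (\<bar>a t\<bar> * V t) - 2 * \<theta> * (\<bar>a t\<bar> * V t * indicator C t)"
  have "1 + \<theta> * ((\<integral>t. \<bar>a t\<bar> * V t \<partial>M) - 2 * \<delta>) \<le>
      1 + \<theta> * (\<integral>t. \<bar>a t\<bar> * V t \<partial>M) - 2 * \<theta> * (\<integral>t. \<bar>a t\<bar> * V t * indicator C t \<partial>M)"
    using mult_left_mono[OF small \<theta>] by (simp add: algebra_simps)
  also have "\<dots> = (\<integral>t. ?l t \<partial>M)"
    using abs_int[OF gi] abs_int[OF ai] aC[of C] g1 by simp
  also have "\<dots> \<le> (\<integral>t. \<bar>g t + \<theta> * a t\<bar> * V t \<partial>M)"
  proof (rule integral_mono)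
    show "integrable M ?l"
      using abs_int[OF gi] abs_int[OF ai] aC[of C] by simp
    show "integrable M (\<lambda>t. \<bar>g t + \<theta> * a t\<bar> * V t)"
      by (rule abs_int[OF sum_int])
    fix t
    have "?l t = (\<bar>g t\<bar> + \<theta> * \<bar>a t\<bar> - 2 * \<theta> * \<bar>a t\<bar> * indicator C t) * V t"
      by (simp add: algebra_simps)
    also have "\<dots> \<le> \<bar>g t + \<theta> * a t\<bar> * V t"
    proof (rule mult_right_mono)
      have "\<bar>\<theta> * a t\<bar> = \<theta> * \<bar>a t\<bar>"
        using \<theta> by (simp add: abs_mult)
      then show "\<bar>g t\<bar> + \<theta> * \<bar>a t\<bar> - 2 * \<theta> * \<bar>a t\<bar> * indicator C t \<le> \<bar>g t + \<theta> * a t\<bar>"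
        using h0[of t] by (cases "t \<in> C") (auto simp: g_def)
    qed (use V[of t] in simp)
    finally show "?l t \<le> \<bar>g t + \<theta> * a t\<bar> * V t" .
  qed
  finally show thesis
    using that[of g] gi g1 c\<phi> by (simp add: \<theta>_def)
qed

context weighted_sum
begin

text \<open>A bounded operator of rank one is \<open>f \<mapsto> \<phi>(f) a\<close>: the coefficient \<open>\<phi>(f)\<close> is unique because \<open>a\<close> is not null, so \<open>\<phi>\<close> inherits linearity
  and a bound from the operator. The estimate for \<open>L\<^sub>1\<close> then applies to \<open>\<phi>\<close>, after a change of sign where \<open>\<phi>\<close> is negative.\<close>

lemma daugavet_of_L1:
  assumes na: "non_atomic M" and conull: "AE t in M. t \<in> \<Gamma>"
    and int: "integrable M (\<lambda>t. V t / W t)" and le: "(\<integral>t. V t / W t \<partial>M) \<le> 1"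
  shows "daugavet_property X"
  unfolding daugavet_property_def
proof (intro allI impI, elim conjE)
  fix T assume T: "bounded_operator X T" and "rank_one X T"
  note L1 = sum_fun_iff_L1[OF conull int le]
  have N_L1: "N f = (\<integral>t. \<bar>f t\<bar> * V t \<partial>M)" if "sum_fun f" for f
    using that N_eq_L1[OF conull int le] by (simp add: L1)
  have T_add: "T (vadd X x y) = vadd X (T x) (T y)" if "x \<in> carrier X" "y \<in> carrier X" for x y
    using T that unfolding bounded_operator_def by blast
  have T_scale: "T (vscale X k x) = vscale X k (T x)" if "x \<in> carrier X" for k x
    using T that unfolding bounded_operator_def by blast
  obtain K where K: "vnorm X (T x) \<le> K * vnorm X x" if "x \<in> carrier X" for x
    using T unfolding bounded_operator_def by blast
  obtain x where x: "x \<in> carrier X" "x \<noteq> vzero X" "T ` carrier X = range (\<lambda>k. vscale X k x)"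
    using \<open>rank_one X T\<close> unfolding rank_one_def by blast
  then obtain a where a: "sum_fun a" "x = real_class M a"
    unfolding X_carrier_iff by blast
  note a_nz = x(2)[unfolded a(2)] and range = x(3)[unfolded a(2)]
  note a = a(1)
  have [measurable]: "a \<in> borel_measurable M"
    using a by (rule sum_fun_measurable)
  have ai: "integrable M (\<lambda>t. a t * V t)"
    using a by (simp add: L1)
  have class_in: "real_class M f \<in> carrier X" if "sum_fun f" for f
    using that by (auto simp: X_carrier_iff)
  have a_not_0: "\<not> (AE t in M. a t = 0)"
    using a_nz by (simp add: X_zero real_class_eq_iff)
  define n where "n = N a"
  have n: "0 < n"
  proof -
    have "n \<noteq> 0"
    proof
      assume "n = 0"
      then have "AE t in M. \<bar>a t\<bar> * V t = 0"
        using integral_nonneg_eq_0_iff_AE[OF integrable_abs_V[OF ai]] less_imp_le[OF V_pos]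
        by (simp add: n_def N_L1[OF a])
      then have "AE t in M. a t = 0"
        using V_pos by (auto simp: less_imp_neq[symmetric] elim!: eventually_mono)
      with a_not_0 show False
        by simp
    qed
    then show ?thesis
      using N_nonneg[OF a] by (simp add: n_def)
  qed
  define \<phi> where "\<phi> f = (SOME k. T (real_class M f) = real_class M (\<lambda>t. k * a t))" for f
  have T_\<phi>: "T (real_class M f) = real_class M (\<lambda>t. \<phi> f * a t)" if "sum_fun f" for f
  proof -
    have "T (real_class M f) \<in> range (\<lambda>k. vscale X k (real_class M a))"
      using class_in[OF that] range by blast
    then have "\<exists>k. T (real_class M f) = real_class M (\<lambda>t. k * a t)"
      by (auto simp: X_scale)
    then show ?thesis
      unfolding \<phi>_def by (rule someI_ex)
  qed
  have unique: "k = l" if "real_class M (\<lambda>t. k * a t) = real_class M (\<lambda>t. l * a t)" for k l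
  proof (rule ccontr)
    assume "k \<noteq> l"
    have "AE t in M. k * a t = l * a t"
      using that by (simp add: real_class_eq_iff)
    then have "AE t in M. a t = 0"
      using \<open>k \<noteq> l\<close> by (auto elim!: eventually_mono)
    with a_not_0 show False
      by simp
  qed
  have \<phi>_add: "\<phi> (\<lambda>t. f t + g t) = \<phi> f + \<phi> g" if fg: "sum_fun f" "sum_fun g" for f g
  proof (rule unique)
    have "real_class M (\<lambda>t. \<phi> (\<lambda>t. f t + g t) * a t) = T (vadd X (real_class M f) (real_class M g))"
      using fg sum_fun_add[OF fg] by (simp add: T_\<phi> X_add sum_fun_measurable)
    also have "\<dots> = real_class M (\<lambda>t. \<phi> f * a t + \<phi> g * a t)"
      using fg class_in by (simp add: T_add T_\<phi> X_add)
    finally show "real_class M (\<lambda>t. \<phi> (\<lambda>t. f t + g t) * a t) = real_class M (\<lambda>t. (\<phi> f + \<phi> g) * a t)"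
      by (simp add: distrib_right)
  qed
  have \<phi>_scale: "\<phi> (\<lambda>t. k * f t) = k * \<phi> f" if f: "sum_fun f" for k f
  proof (rule unique)
    have "real_class M (\<lambda>t. \<phi> (\<lambda>t. k * f t) * a t) = T (vscale X k (real_class M f))"
      using f sum_fun_scale[OF f, of k] by (simp add: T_\<phi> X_scale sum_fun_measurable)
    also have "\<dots> = real_class M (\<lambda>t. k * (\<phi> f * a t))"
      using f class_in by (simp add: T_scale T_\<phi> X_scale)
    finally show "real_class M (\<lambda>t. \<phi> (\<lambda>t. k * f t) * a t) = real_class M (\<lambda>t. (k * \<phi> f) * a t)"
      by (simp add: mult.assoc)
  qed
  have T_norm: "vnorm X (T (real_class M f)) = \<bar>\<phi> f\<bar> * n" if "sum_fun f" for f
    using that by (simp add: T_\<phi> X_norm sum_fun_scale[OF a] N_scale[OF a] n_def)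
  have \<phi>_bound: "\<bar>\<phi> f\<bar> \<le> K / n * N f" if f: "sum_fun f" for f
    using K[OF class_in[OF f]] n unfolding T_norm[OF f] X_norm[OF f] by (simp add: field_simps)
  have sum_norm: "vnorm X (vadd X (real_class M f) (T (real_class M f))) = N (\<lambda>t. f t + \<phi> f * a t)"
    if f: "sum_fun f" for f
    using X_norm[OF sum_fun_add[OF f sum_fun_scale[OF a, of "\<phi> f"]]] f
    by (simp add: T_\<phi> X_add sum_fun_measurable)

  define ball where "ball = {x \<in> carrier X. vnorm X x \<le> 1}"
  have ballE: "\<exists>f. sum_fun f \<and> N f \<le> 1 \<and> x = real_class M f" if "x \<in> ball" for x
    using that by (auto simp: ball_def X_carrier_iff X_norm)
  have ballI: "real_class M f \<in> ball" if "sum_fun f" "N f \<le> 1" for f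
    using that by (auto simp: ball_def X_carrier_iff X_norm)
  have T_le: "vnorm X (T x) \<le> \<bar>K\<bar>" if x: "x \<in> ball" for x
  proof -
    from ballE[OF x] obtain f where f: "sum_fun f" "N f \<le> 1" "x = real_class M f"
      by blast
    have "K * N f \<le> \<bar>K\<bar> * N f"
      by (rule mult_right_mono[OF abs_ge_self N_nonneg[OF f(1)]])
    also have "\<dots> \<le> \<bar>K\<bar>"
      using mult_left_mono[OF f(2), of "\<bar>K\<bar>"] by simp
    finally show ?thesis
      using K[OF class_in[OF f(1)]] by (simp add: f(3) X_norm[OF f(1)])
  qed
  have T_bdd: "bdd_above ((\<lambda>x. vnorm X (T x)) ` ball)"
    using T_le by (rule bdd_aboveI2)
  have triangle: "vnorm X (vadd X x (T x)) \<le> 1 + vnorm X (T x)" if x: "x \<in> ball" for x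
  proof -
    from ballE[OF x] obtain f where f: "sum_fun f" "N f \<le> 1" "x = real_class M f"
      by blast
    have "N (\<lambda>t. f t + \<phi> f * a t) \<le> N f + \<bar>\<phi> f\<bar> * n"
      using N_triangle[OF f(1) sum_fun_scale[OF a, of "\<phi> f"]] by (simp add: N_scale[OF a] n_def)
    then show ?thesis
      using f(2) unfolding f(3) sum_norm[OF f(1)] T_norm[OF f(1)] by simp
  qed
  have I_bdd: "bdd_above ((\<lambda>x. vnorm X (vadd X x (T x))) ` ball)"
    by (rule bdd_aboveI2[of _ _ "1 + \<bar>K\<bar>"]) (use triangle T_le in force)

  define S where "S = (SUP x\<in>ball. vnorm X (vadd X x (T x)))"
  have S_ge: "N (\<lambda>t. f t + \<phi> f * a t) \<le> S" if f: "sum_fun f" "N f \<le> 1" for f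
    unfolding S_def sum_norm[OF f(1), symmetric] by (rule cSUP_upper[OF ballI[OF f] I_bdd])
  have key: "\<phi> f * n \<le> S - 1" if f: "sum_fun f" "N f \<le> 1" "0 < \<phi> f" for f
  proof (rule field_le_mult_one_interval)
    fix y :: real assume y: "0 < y" "y < 1"
    show "y * (\<phi> f * n) \<le> S - 1"
    proof (rule field_le_mult_one_interval)
      fix z :: real assume z: "0 < z" "z < 1"
      \<comment> \<open>The factors \<open>y\<close> and \<open>z\<close> absorb the loss in \<open>\<phi>\<close> and the loss \<open>2 \<delta>\<close> in the norm of \<open>a\<close>.\<close>
      define \<delta> where "\<delta> = (1 - z) * n / 2"
      have "2 * \<delta> = (1 - z) * n"
        by (simp add: \<delta>_def)
      then have \<delta>: "0 < \<delta>" "n - 2 * \<delta> = z * n"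
        using z n by (auto simp: \<delta>_def algebra_simps)
      have c: "0 \<le> y * \<phi> f" "y * \<phi> f < \<phi> f"
        using y f(3) by auto
      have fi: "f \<in> borel_measurable M" "integrable M (\<lambda>t. f t * V t)" "(\<integral>t. \<bar>f t\<bar> * V t \<partial>M) \<le> 1"
        using f(1,2) by (simp_all add: L1 flip: N_L1)
      obtain g where g: "g \<in> borel_measurable M" "integrable M (\<lambda>t. g t * V t)"
          "(\<integral>t. \<bar>g t\<bar> * V t \<partial>M) = 1" "y * \<phi> f < \<phi> g"
        and g_ge: "1 + \<phi> g * ((\<integral>t. \<bar>a t\<bar> * V t \<partial>M) - 2 * \<delta>) \<le> (\<integral>t. \<bar>g t + \<phi> g * a t\<bar> * V t \<partial>M)"
      proof (rule L1_daugavet_estimate[OF na V V_pos, of \<phi> "K / n" a f "y * \<phi> f" \<delta>])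
        show "\<phi> (\<lambda>t. f t + g t) = \<phi> f + \<phi> g" if "f \<in> borel_measurable M" "integrable M (\<lambda>t. f t * V t)"
          "g \<in> borel_measurable M" "integrable M (\<lambda>t. g t * V t)" for f g
          using that by (intro \<phi>_add) (simp_all add: L1)
        show "\<phi> (\<lambda>t. k * f t) = k * \<phi> f" if "f \<in> borel_measurable M" "integrable M (\<lambda>t. f t * V t)" for k f
          using that by (intro \<phi>_scale) (simp add: L1)
        show "\<bar>\<phi> f\<bar> \<le> K / n * (\<integral>t. \<bar>f t\<bar> * V t \<partial>M)"
          if "f \<in> borel_measurable M" "integrable M (\<lambda>t. f t * V t)" for f
          using \<phi>_bound[of f] N_L1[of f] that by (simp add: L1)
      qed (use ai fi c \<delta>(1) in auto)
      have g': "sum_fun g"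
        using g by (simp add: L1)
      have "z * (y * (\<phi> f * n)) = (y * \<phi> f) * (z * n)"
        by simp
      also have "\<dots> \<le> \<phi> g * (z * n)"
        using g(4) z n by (intro mult_right_mono) auto
      also have "\<dots> \<le> N (\<lambda>t. g t + \<phi> g * a t) - 1"
        using g_ge N_L1[OF sum_fun_add[OF g' sum_fun_scale[OF a, of "\<phi> g"]]]
        by (simp add: n_def[symmetric] \<delta>(2) flip: N_L1[OF a])
      also have "\<dots> \<le> S - 1"
        using S_ge[OF g'] g(3) N_L1[OF g'] by simp
      finally show "z * (y * (\<phi> f * n)) \<le> S - 1" .
    qed
  qed
  \<comment> \<open>Since \<open>T\<close> is nonzero, \<open>\<phi>\<close> takes a positive value in the unit ball; this covers the points where \<open>\<phi>\<close> vanishes.\<close>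
  have S1: "1 \<le> S"
  proof -
    have "vscale X 1 (real_class M a) \<in> T ` carrier X"
      unfolding range by blast
    then obtain f where f: "sum_fun f" "real_class M (\<lambda>t. 1 * a t) = T (real_class M f)"
      by (auto simp: X_carrier_iff X_scale)
    then have \<phi>1: "\<phi> f = 1"
      using unique[of 1 "\<phi> f"] by (simp add: T_\<phi>)
    let ?k = "inverse (N f + 1)"
    have k: "0 < ?k" "?k * N f \<le> 1"
      using N_nonneg[OF f(1)] by (auto simp: field_simps)
    have "\<phi> (\<lambda>t. ?k * f t) * n \<le> S - 1"
      using k by (intro key sum_fun_scale f) (simp_all add: N_scale[OF f(1)] \<phi>_scale[OF f(1)] \<phi>1)
    moreover have "0 < \<phi> (\<lambda>t. ?k * f t) * n"
      using k n by (simp add: \<phi>_scale[OF f(1)] \<phi>1)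
    ultimately show ?thesis
      by linarith
  qed
  have "real_class M (\<lambda>t. 0 * a t) \<in> ball"
    by (intro ballI sum_fun_scale a) (subst N_scale[OF a], simp)
  then have ne: "ball \<noteq> {}"
    by blast
  show "operator_norm X (\<lambda>x. vadd X x (T x)) = 1 + operator_norm X T"
    unfolding operator_norm_def ball_def[symmetric] S_def[symmetric]
  proof (rule antisym)
    show "S \<le> 1 + (SUP x\<in>ball. vnorm X (T x))"
      unfolding S_def
    proof (rule cSUP_least[OF ne])
      fix x assume x: "x \<in> ball"
      show "vnorm X (vadd X x (T x)) \<le> 1 + (SUP x\<in>ball. vnorm X (T x))"
        using triangle[OF x] cSUP_upper[OF x T_bdd] by simp
    qed
    have "(SUP x\<in>ball. vnorm X (T x)) \<le> S - 1"
    proof (rule cSUP_least[OF ne])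
      fix x assume "x \<in> ball"
      then obtain f where f: "sum_fun f" "N f \<le> 1" "x = real_class M f"
        using ballE by blast
      consider "0 < \<phi> f" | "0 < - \<phi> f" | "\<phi> f = 0"
        by linarith
      then have "\<bar>\<phi> f\<bar> * n \<le> S - 1"
      proof cases
        case 1
        then show ?thesis
          using key[OF f(1,2)] by simp
      next
        case 2
        have "\<phi> (\<lambda>t. - 1 * f t) * n \<le> S - 1"
        proof (rule key[OF sum_fun_scale[OF f(1)]])
          show "N (\<lambda>t. - 1 * f t) \<le> 1"
            unfolding N_scale[OF f(1)] using f(2) by simp
          show "0 < \<phi> (\<lambda>t. - 1 * f t)"
            unfolding \<phi>_scale[OF f(1)] using 2 by simp
        qed
        then show ?thesis
          using 2 unfolding \<phi>_scale[OF f(1)] by simp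
      next
        case 3
        then show ?thesis
          using S1 by simp
      qed
      then show "vnorm X (T x) \<le> S - 1"
        by (simp add: f(3) T_norm[OF f(1)])
    qed
    then show "1 + (SUP x\<in>ball. vnorm X (T x)) \<le> S"
      by simp
  qed
qed

end

section \<open>The characterization\<close>

theorem theorem3p5:
  fixes M :: "'a measure" and \<Gamma> :: "'a set" and v w :: "'a \<Rightarrow> ereal"
  defines "X \<equiv> sum_space M \<Gamma> v w"
  assumes "sigma_finite_measure M" and "complete_measure M" and "non_atomic M"
    and "\<Gamma> \<in> sets M" and "emeasure M \<Gamma> > 0"
    and "weight_on M \<Gamma> v" and "weight_on M (space M) w"
  shows "(daugavet_property X \<longleftrightarrow>
            carrier X = carrier (L1_space M v (space M)) \<and>
            (\<forall>x\<in>carrier X. vnorm X x = vnorm (L1_space M v (space M)) x))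
       \<and> (daugavet_property X \<longleftrightarrow>
            emeasure M (space M - \<Gamma>) = 0 \<and> (\<integral>\<^sup>+t. e2ennreal (v t / w t) \<partial>M) \<le> 1)"
proof -
  \<comment> \<open>The default 1 keeps the version positive where \<open>u\<close> is not positive and finite.\<close>
  define pos where "pos u t = (if 0 < u t \<and> u t < \<infinity> then real_of_ereal (u t) else 1)" for u :: "'a \<Rightarrow> ereal" and t
  have [measurable]: "v \<in> borel_measurable M" "w \<in> borel_measurable M"
    using assms(7,8) by (auto simp: weight_on_def)
  have pos: "0 < pos u t" for u t
    by (cases "u t") (auto simp: pos_def)
  have pos_eq: "u t = ereal (pos u t)" if "0 < u t" "u t < \<infinity>" for u t
    using that by (cases "u t") (auto simp: pos_def)
  interpret weighted_sum M \<Gamma> v w "pos v" "pos w"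
  proof
    show "pos v \<in> borel_measurable M" "pos w \<in> borel_measurable M"
      unfolding pos_def by measurable
    show "AE t in M. t \<in> \<Gamma> \<longrightarrow> v t = ereal (pos v t)"
      using assms(7) pos_eq[of v] by (auto simp: weight_on_def elim!: eventually_mono)
    show "AE t in M. w t = ereal (pos w t)"
      using assms(8) AE_space pos_eq[of w] unfolding weight_on_def by (auto elim!: eventually_elim2)
  qed (use assms pos in auto)
  let ?ii = "carrier X = carrier (L1_space M v (space M)) \<and>
      (\<forall>x\<in>carrier X. vnorm X x = vnorm (L1_space M v (space M)) x)"
  let ?iii = "(AE t in M. t \<in> \<Gamma>) \<and> (\<integral>\<^sup>+t. e2ennreal (v t / w t) \<partial>M) \<le> 1"
  have "?iii \<Longrightarrow> daugavet_property X"
    unfolding X_def using daugavet_of_L1[OF assms(4)] nn_integral_quotient_le_iff(2) by blast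
  moreover have "?iii \<Longrightarrow> ?ii"
    unfolding X_def using sum_space_eq_L1 nn_integral_quotient_le_iff(2) by blast
  moreover have "daugavet_property X \<Longrightarrow> ?iii"
    unfolding X_def using daugavet_imp_conull[OF assms(2,6)] daugavet_imp_quotient_le[OF assms(2)]
      nn_integral_quotient_le_iff(1) by simp
  moreover have "?ii \<Longrightarrow> ?iii"
    unfolding X_def using eq_L1_imp_conull[OF assms(4)] eq_L1_imp_quotient_le by blast
  ultimately show ?thesis
    unfolding conull_iff by blast
qed

end
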